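(* Let $f:[0,\infty[\to\mathbb{R}^d$ be a càdlàg function. Then $f$ is Itô-expandable if and only if $f$ is Hunt-expandable and in addition each component of the vector $f-f(0)$ is absolutely continuous with respect to Lebesgue measure.
   Context: A deterministic (time homogeneous, universal) Markov process on $\mathbb{R}^d$ is a family $(X^x)_{x\in\mathbb{R}^d}$ of functions (paths) $t\mapsto X_t^x$, $[0,\infty[\to\mathbb{R}^d$, not depending on $\omega$, with $X_0^x=x$ for every $x$, such that: whenever $X_s^x=X_t^y$ for some $s,t\ge 0$ and $x,y\in\mathbb{R}^d$, then $X_{s+h}^x=X_{t+h}^y$ for every $h\ge 0$. All paths are assumed to be càdlàg (right-continuous with left limits). A deterministic Markov process is a deterministic Hunt process if in addition it is quasi-left continuous for every starting point, which for deterministic processes is equivalent to left continuity of all paths. The process is viewed as a stochastic process on a fixed stochastic basis with $X_t^x(\omega)$ independent of $\omega$. It is a semimartingale if $X^x$ is a semimartingale for every $x$ (for deterministic processes: every path is càdlàg and of finite variation on compact intervals). A Markov semimartingale $X$ is called an Itô process if, for every starting point, its semimartingale characteristics $(B,C,\nu)$ (with respect to a fixed truncation function) have the form $$B_t^{(j)}=\int_0^t \ell^{(j)}(X_s)\,ds,\quad C_t^{jk}=\int_0^t Q^{jk}(X_s)\,ds,\quad \nu(ds,dy)=N(X_s,dy)\,ds\qquad (j,k=1,\dots,d),$$ where $\ell^{(j)},Q^{jk}:\mathbb{R}^d\to\mathbb{R}$ are measurable functions (not depending on the starting point), $Q(x)=(Q^{jk}(x))_{1\le j,k\le d}$ is positive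 semidefinite for every $x\in\mathbb{R}^d$, and $N(x,\cdot)$ is a Borel transition kernel on $\mathbb{R}^d\times\mathcal{B}(\mathbb{R}^d\setminus\{0\})$. $f$ is Hunt-expandable (respectively Itô-expandable) if there exists a deterministic Hunt (respectively Itô) process $(X^x)_{x\in\mathbb{R}^d}$ with $X_t^{f(0)}=f(t)$ for every $t\ge0$. A function $g:[0,\infty[\to\mathbb{R}$ with $g(0)=0$ is absolutely continuous with respect to Lebesgue measure if $g(t)=\int_0^t b(s)\,ds$ for all $t\ge0$ with some locally integrable $b$. *)

theory Defs
  imports "HOL-Probability.Probability"
begin

section \<open>Paths\<close>

text \<open>
  The time set is \<open>[0, \<infinity>)\<close>.  Paths and processes are functions of a \<open>real\<close> argument whose values
  at negative times are never referred to.
\<close>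

definition cadlag :: "(real \<Rightarrow> 'a::t2_space) \<Rightarrow> bool" where
  "cadlag g \<longleftrightarrow> (\<forall>t\<ge>0. (g \<longlongrightarrow> g t) (at_right t)) \<and> (\<forall>t>0. \<exists>l. (g \<longlongrightarrow> l) (at_left t))"

definition jump :: "(real \<Rightarrow> 'a::real_normed_vector) \<Rightarrow> real \<Rightarrow> 'a" where
  "jump g t = (if t > 0 then g t - Lim (at_left t) g else 0)"

definition finite_variation :: "(real \<Rightarrow> real) \<Rightarrow> bool" where
  "finite_variation g \<longleftrightarrow>
     (\<forall>t\<ge>0. \<exists>K. \<forall>n p. mono p \<and> range p \<subseteq> {0..t} \<longrightarrow>
        (\<Sum>i<n. \<bar>g (p (Suc i)) - g (p i)\<bar>) \<le> K)"

definition abs_continuous :: "(real \<Rightarrow> real) \<Rightarrow> bool" where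
  "abs_continuous g \<longleftrightarrow>
     (\<exists>b. \<forall>t\<ge>0. set_integrable lborel {0..t} b \<and> g t = (LINT s:{0..t}|lborel. b s))"


section \<open>Stochastic basis, martingales, semimartingales\<close>

text \<open>
  The conventions are those of Jacod and Shiryaev, Limit Theorems for Stochastic Processes,
  Chapters I and II: the filtration is right-continuous, but it need not be complete.
\<close>

definition stochastic_basis :: "'w measure \<Rightarrow> (real \<Rightarrow> 'w measure) \<Rightarrow> bool" where
  "stochastic_basis M F \<longleftrightarrow>
     prob_space M \<and> filtration (space M) F \<and> (\<forall>t. subalgebra M (F t)) \<and>
     (\<forall>t\<ge>0. sets (F t) = (\<Inter>u\<in>{t<..}. sets (F u)))"

definition martingale :: "'w measure \<Rightarrow> (real \<Rightarrow> 'w measure) \<Rightarrow> (real \<Rightarrow> 'w \<Rightarrow> real) \<Rightarrow> bool" where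
  "martingale M F L \<longleftrightarrow>
     (\<forall>t\<ge>0. L t \<in> borel_measurable (F t)) \<and>
     (AE \<omega> in M. cadlag (\<lambda>t. L t \<omega>)) \<and>
     (\<forall>t\<ge>0. integrable M (L t)) \<and>
     (\<forall>s t. 0 \<le> s \<and> s \<le> t \<longrightarrow> (AE \<omega> in M. real_cond_exp M (F s) (L t) \<omega> = L s \<omega>))"

text \<open>
  Localizing sequences may be taken to consist of finite stopping times (replace \<open>T n\<close> by
  \<open>min (T n) n\<close>, which also makes the stopped martingale uniformly integrable).
\<close>

definition local_martingale :: "'w measure \<Rightarrow> (real \<Rightarrow> 'w measure) \<Rightarrow> (real \<Rightarrow> 'w \<Rightarrow> real) \<Rightarrow> bool" where
  "local_martingale M F L \<longleftrightarrow>
     (\<exists>T :: nat \<Rightarrow> 'w \<Rightarrow> real.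
        (\<forall>n. stopping_time F (T n)) \<and>
        (\<forall>n. \<forall>\<omega>\<in>space M. 0 \<le> T n \<omega> \<and> T n \<omega> \<le> T (Suc n) \<omega>) \<and>
        (AE \<omega> in M. filterlim (\<lambda>n. T n \<omega>) at_top sequentially) \<and>
        (\<forall>n. martingale M F (\<lambda>t \<omega>. L (min t (T n \<omega>)) \<omega>)))"

definition null_local_martingale :: "'w measure \<Rightarrow> (real \<Rightarrow> 'w measure) \<Rightarrow> (real \<Rightarrow> 'w \<Rightarrow> real) \<Rightarrow> bool" where
  "null_local_martingale M F L \<longleftrightarrow> local_martingale M F L \<and> (\<forall>\<omega>\<in>space M. L 0 \<omega> = 0)"

definition fv_process :: "'w measure \<Rightarrow> (real \<Rightarrow> 'w measure) \<Rightarrow> (real \<Rightarrow> 'w \<Rightarrow> real) \<Rightarrow> bool" where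
  "fv_process M F A \<longleftrightarrow>
     (\<forall>t\<ge>0. A t \<in> borel_measurable (F t)) \<and>
     (\<forall>\<omega>\<in>space M. A 0 \<omega> = 0 \<and> cadlag (\<lambda>t. A t \<omega>) \<and> finite_variation (\<lambda>t. A t \<omega>))"

definition semimartingale1 :: "'w measure \<Rightarrow> (real \<Rightarrow> 'w measure) \<Rightarrow> (real \<Rightarrow> 'w \<Rightarrow> real) \<Rightarrow> bool" where
  "semimartingale1 M F X \<longleftrightarrow>
     X 0 \<in> borel_measurable (F 0) \<and>
     (\<exists>L A. null_local_martingale M F L \<and> fv_process M F A \<and>
        (\<forall>t\<ge>0. \<forall>\<omega>\<in>space M. X t \<omega> = X 0 \<omega> + L t \<omega> + A t \<omega>))"

definition semimartingale :: "'w measure \<Rightarrow> (real \<Rightarrow> 'w measure) \<Rightarrow> (real \<Rightarrow> 'w \<Rightarrow> real^'d) \<Rightarrow> bool" where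
  "semimartingale M F X \<longleftrightarrow> (\<forall>j. semimartingale1 M F (\<lambda>t \<omega>. X t \<omega> $ j))"

text \<open>
  Along an increasing sequence of stopping times with limit \<open>\<tau>\<close>, the values of \<open>X\<close> converge a.s. on
  \<open>{\<tau> < \<infinity>}\<close>.  Again finite stopping times suffice, since \<open>T n\<close> can be capped at any constant.
\<close>

definition quasi_left_continuous ::
    "'w measure \<Rightarrow> (real \<Rightarrow> 'w measure) \<Rightarrow> (real \<Rightarrow> 'w \<Rightarrow> 'a::topological_space) \<Rightarrow> bool" where
  "quasi_left_continuous M F X \<longleftrightarrow>
     (\<forall>T :: nat \<Rightarrow> 'w \<Rightarrow> real.
        (\<forall>n. stopping_time F (T n)) \<and>
        (\<forall>n. \<forall>\<omega>\<in>space M. 0 \<le> T n \<omega> \<and> T n \<omega> \<le> T (Suc n) \<omega>) \<longrightarrow>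
        (AE \<omega> in M. \<forall>\<tau>. (\<lambda>n. T n \<omega>) \<longlonglongrightarrow> \<tau> \<longrightarrow> (\<lambda>n. X (T n \<omega>) \<omega>) \<longlonglongrightarrow> X \<tau> \<omega>))"


section \<open>Semimartingale characteristics\<close>

definition predictable_space :: "'w measure \<Rightarrow> (real \<Rightarrow> 'w measure) \<Rightarrow> (real \<times> 'w) measure" where
  "predictable_space M F =
     sigma ({0..} \<times> space M)
       ({{0} \<times> A | A. A \<in> sets (F 0)} \<union>
        {{s<..t} \<times> A | s t A. 0 \<le> s \<and> s \<le> t \<and> A \<in> sets (F s)})"

definition predictable_fv_process ::
    "'w measure \<Rightarrow> (real \<Rightarrow> 'w measure) \<Rightarrow> (real \<Rightarrow> 'w \<Rightarrow> real) \<Rightarrow> bool" where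
  "predictable_fv_process M F A \<longleftrightarrow>
     fv_process M F A \<and> (\<lambda>(t, \<omega>). A t \<omega>) \<in> borel_measurable (predictable_space M F)"

definition continuous_null_local_martingale ::
    "'w measure \<Rightarrow> (real \<Rightarrow> 'w measure) \<Rightarrow> (real \<Rightarrow> 'w \<Rightarrow> real) \<Rightarrow> bool" where
  "continuous_null_local_martingale M F L \<longleftrightarrow>
     null_local_martingale M F L \<and> (AE \<omega> in M. continuous_on {0..} (\<lambda>t. L t \<omega>))"

definition purely_discontinuous ::
    "'w measure \<Rightarrow> (real \<Rightarrow> 'w measure) \<Rightarrow> (real \<Rightarrow> 'w \<Rightarrow> real) \<Rightarrow> bool" where
  "purely_discontinuous M F L \<longleftrightarrow>
     null_local_martingale M F L \<and>
     (\<forall>K. local_martingale M F K \<and> (AE \<omega> in M. continuous_on {0..} (\<lambda>t. K t \<omega>)) \<longrightarrow>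
        local_martingale M F (\<lambda>t \<omega>. L t \<omega> * K t \<omega>))"

definition continuous_martingale_part ::
    "'w measure \<Rightarrow> (real \<Rightarrow> 'w measure) \<Rightarrow> (real \<Rightarrow> 'w \<Rightarrow> real) \<Rightarrow> (real \<Rightarrow> 'w \<Rightarrow> real) \<Rightarrow> bool" where
  "continuous_martingale_part M F X Xc \<longleftrightarrow>
     continuous_null_local_martingale M F Xc \<and>
     (\<exists>D A. purely_discontinuous M F D \<and> fv_process M F A \<and>
        (\<forall>t\<ge>0. \<forall>\<omega>\<in>space M. X t \<omega> = X 0 \<omega> + Xc t \<omega> + D t \<omega> + A t \<omega>))"

text \<open>The predictable covariation \<open>\<langle>K, L\<rangle>\<close> of two continuous local martingales null at zero.\<close>

definition predictable_covariation ::
    "'w measure \<Rightarrow> (real \<Rightarrow> 'w measure) \<Rightarrow> (real \<Rightarrow> 'w \<Rightarrow> real) \<Rightarrow> (real \<Rightarrow> 'w \<Rightarrow> real) \<Rightarrow>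
     (real \<Rightarrow> 'w \<Rightarrow> real) \<Rightarrow> bool" where
  "predictable_covariation M F K L C \<longleftrightarrow>
     predictable_fv_process M F C \<and> local_martingale M F (\<lambda>t \<omega>. K t \<omega> * L t \<omega> - C t \<omega>)"

definition truncation_function :: "('v::real_normed_vector \<Rightarrow> 'v) \<Rightarrow> bool" where
  "truncation_function h \<longleftrightarrow>
     h \<in> borel_measurable borel \<and> bounded (range h) \<and> (\<exists>\<epsilon>>0. \<forall>y. norm y < \<epsilon> \<longrightarrow> h y = y)"

text \<open>
  For a cadlag path only finitely many summands are nonzero on \<open>(0, t]\<close>, because \<open>h\<close> is the
  identity near \<open>0\<close>.
\<close>

definition remove_big_jumps ::
    "('v::real_normed_vector \<Rightarrow> 'v) \<Rightarrow> (real \<Rightarrow> 'v) \<Rightarrow> real \<Rightarrow> 'v" where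
  "remove_big_jumps h g t =
     g t - (\<Sum>s\<in>{s. 0 < s \<and> s \<le> t \<and> h (jump g s) \<noteq> jump g s}. jump g s - h (jump g s))"

definition mark_space :: "'v::{topological_space, zero} measure" where
  "mark_space = restrict_space borel (- {0})"

definition time_mark_space :: "(real \<times> 'v::{topological_space, zero}) measure" where
  "time_mark_space = restrict_space borel {0..} \<Otimes>\<^sub>M mark_space"

text \<open>The sum of the unit masses at \<open>(s, jump g s)\<close> over all jump times \<open>s\<close> of \<open>g\<close>.\<close>

definition jump_measure :: "(real \<Rightarrow> 'v::real_normed_vector) \<Rightarrow> (real \<times> 'v) measure" where
  "jump_measure g =
     distr (count_space {s. 0 < s \<and> jump g s \<noteq> 0}) time_mark_space (\<lambda>s. (s, jump g s))"

text \<open>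
  Predictable integrands are functions on \<open>([0, \<infinity>) \<times> \<Omega>) \<times> (- {0})\<close>; the integral process of
  such a nonnegative function with respect to a random measure.
\<close>

definition random_measure_integral ::
    "((real \<times> 'w) \<times> 'v \<Rightarrow> ennreal) \<Rightarrow> ('w \<Rightarrow> (real \<times> 'v) measure) \<Rightarrow> real \<Rightarrow> 'w \<Rightarrow> ennreal" where
  "random_measure_integral W \<nu> t \<omega> =
     (\<integral>\<^sup>+(s, y). W ((s, \<omega>), y) * indicator {..t} s \<partial>\<nu> \<omega>)"

definition predictable_random_measure ::
    "'w measure \<Rightarrow> (real \<Rightarrow> 'w measure) \<Rightarrow>
     ('w \<Rightarrow> (real \<times> 'v::{topological_space, zero}) measure) \<Rightarrow> bool" where
  "predictable_random_measure M F \<nu> \<longleftrightarrow>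
     (\<forall>\<omega>\<in>space M. sets (\<nu> \<omega>) = sets time_mark_space \<and> emeasure (\<nu> \<omega>) ({0} \<times> (- {0})) = 0) \<and>
     (\<forall>W \<in> borel_measurable (predictable_space M F \<Otimes>\<^sub>M mark_space).
        (\<lambda>(t, \<omega>). random_measure_integral W \<nu> t \<omega>) \<in> borel_measurable (predictable_space M F))"

definition jump_compensator ::
    "'w measure \<Rightarrow> (real \<Rightarrow> 'w measure) \<Rightarrow> (real \<Rightarrow> 'w \<Rightarrow> 'v::real_normed_vector) \<Rightarrow>
     ('w \<Rightarrow> (real \<times> 'v) measure) \<Rightarrow> bool" where
  "jump_compensator M F X \<nu> \<longleftrightarrow>
     predictable_random_measure M F \<nu> \<and>
     (\<forall>W \<in> borel_measurable (predictable_space M F \<Otimes>\<^sub>M mark_space).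
        (\<integral>\<^sup>+\<omega>. (\<integral>\<^sup>+(s, y). W ((s, \<omega>), y) \<partial>\<nu> \<omega>) \<partial>M) =
        (\<integral>\<^sup>+\<omega>. (\<integral>\<^sup>+(s, y). W ((s, \<omega>), y) \<partial>jump_measure (\<lambda>t. X t \<omega>)) \<partial>M))"

text \<open>
  \<open>(B, C, \<nu>)\<close> is a version of the characteristics of \<open>X\<close> relative to \<open>h\<close>:  \<open>B\<close> is the predictable
  finite variation part of the special semimartingale obtained by removing the big jumps, \<open>C\<close> is the
  covariation of the continuous martingale part, \<open>\<nu>\<close> is the compensator of the jump measure.
\<close>

definition characteristics ::
    "'w measure \<Rightarrow> (real \<Rightarrow> 'w measure) \<Rightarrow> (real^'d \<Rightarrow> real^'d) \<Rightarrow> (real \<Rightarrow> 'w \<Rightarrow> real^'d) \<Rightarrow>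
     (real \<Rightarrow> 'w \<Rightarrow> real^'d) \<Rightarrow> (real \<Rightarrow> 'w \<Rightarrow> real^'d^'d) \<Rightarrow>
     ('w \<Rightarrow> (real \<times> (real^'d)) measure) \<Rightarrow> bool" where
  "characteristics M F h X B C \<nu> \<longleftrightarrow>
     semimartingale M F X \<and>
     (\<forall>j. predictable_fv_process M F (\<lambda>t \<omega>. B t \<omega> $ j) \<and>
        null_local_martingale M F
          (\<lambda>t \<omega>. (remove_big_jumps h (\<lambda>s. X s \<omega>) t - X 0 \<omega> - B t \<omega>) $ j)) \<and>
     (\<exists>Xc. (\<forall>j. continuous_martingale_part M F (\<lambda>t \<omega>. X t \<omega> $ j) (Xc j)) \<and>
        (\<forall>j k. predictable_covariation M F (Xc j) (Xc k) (\<lambda>t \<omega>. C t \<omega> $ j $ k))) \<and>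
     jump_compensator M F X \<nu>"


section \<open>Ito processes\<close>

definition positive_semidefinite :: "real^'d^'d \<Rightarrow> bool" where
  "positive_semidefinite Q \<longleftrightarrow> transpose Q = Q \<and> (\<forall>v. 0 \<le> v \<bullet> (Q *v v))"

definition transition_kernel :: "('v::{topological_space, zero} \<Rightarrow> 'v measure) \<Rightarrow> bool" where
  "transition_kernel N \<longleftrightarrow>
     (\<forall>x. sets (N x) = sets mark_space) \<and>
     (\<forall>A\<in>sets mark_space. (\<lambda>x. emeasure (N x) A) \<in> borel_measurable borel)"

text \<open>
  \<open>X x\<close> is the process started at \<open>x\<close>.  As characteristics are only determined up to null sets, some
  version of them is required to be of the stated form.  The local integrability that the formulas
  for \<open>B\<close> and \<open>C\<close> presuppose is explicit, since otherwise the integral would be \<open>0\<close> by convention;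
  the formula for \<open>\<nu>\<close> is expressed on the sets \<open>[0, t] \<times> A\<close>.
\<close>

definition ito_process ::
    "'w measure \<Rightarrow> (real \<Rightarrow> 'w measure) \<Rightarrow> (real^'d \<Rightarrow> real^'d) \<Rightarrow>
     (real^'d \<Rightarrow> real \<Rightarrow> 'w \<Rightarrow> real^'d) \<Rightarrow> bool" where
  "ito_process M F h X \<longleftrightarrow>
     (\<exists>(\<l> :: real^'d \<Rightarrow> real^'d) (Q :: real^'d \<Rightarrow> real^'d^'d) (N :: real^'d \<Rightarrow> (real^'d) measure).
        (\<forall>j. (\<lambda>x. \<l> x $ j) \<in> borel_measurable borel) \<and>
        (\<forall>j k. (\<lambda>x. Q x $ j $ k) \<in> borel_measurable borel) \<and>
        (\<forall>x. positive_semidefinite (Q x)) \<and>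
        transition_kernel N \<and>
        (\<forall>x. \<exists>B C \<nu>. characteristics M F h (X x) B C \<nu> \<and>
           (AE \<omega> in M. \<forall>t\<ge>0.
              (\<forall>j. set_integrable lborel {0..t} (\<lambda>s. \<l> (X x s \<omega>) $ j) \<and>
                 B t \<omega> $ j = (LINT s:{0..t}|lborel. \<l> (X x s \<omega>) $ j)) \<and>
              (\<forall>j k. set_integrable lborel {0..t} (\<lambda>s. Q (X x s \<omega>) $ j $ k) \<and>
                 C t \<omega> $ j $ k = (LINT s:{0..t}|lborel. Q (X x s \<omega>) $ j $ k)) \<and>
              (\<forall>A\<in>sets mark_space.
                 emeasure (\<nu> \<omega>) ({0..t} \<times> A) =
                   (\<integral>\<^sup>+s\<in>{0..t}. emeasure (N (X x s \<omega>)) A \<partial>lborel)))))"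


section \<open>Deterministic processes\<close>

definition deterministic_markov :: "('v::t2_space \<Rightarrow> real \<Rightarrow> 'v) \<Rightarrow> bool" where
  "deterministic_markov X \<longleftrightarrow>
     (\<forall>x. X x 0 = x) \<and> (\<forall>x. cadlag (X x)) \<and>
     (\<forall>x y. \<forall>s\<ge>0. \<forall>t\<ge>0. X x s = X y t \<longrightarrow> (\<forall>h\<ge>0. X x (s + h) = X y (t + h)))"

definition deterministic_hunt ::
    "'w measure \<Rightarrow> (real \<Rightarrow> 'w measure) \<Rightarrow> (real^'d \<Rightarrow> real \<Rightarrow> real^'d) \<Rightarrow> bool" where
  "deterministic_hunt M F X \<longleftrightarrow>
     deterministic_markov X \<and> (\<forall>x. quasi_left_continuous M F (\<lambda>t \<omega>. X x t))"

definition deterministic_ito ::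
    "'w measure \<Rightarrow> (real \<Rightarrow> 'w measure) \<Rightarrow> (real^'d \<Rightarrow> real^'d) \<Rightarrow>
     (real^'d \<Rightarrow> real \<Rightarrow> real^'d) \<Rightarrow> bool" where
  "deterministic_ito M F h X \<longleftrightarrow>
     deterministic_markov X \<and> ito_process M F h (\<lambda>x t \<omega>. X x t)"

definition hunt_expandable ::
    "'w measure \<Rightarrow> (real \<Rightarrow> 'w measure) \<Rightarrow> (real \<Rightarrow> real^'d) \<Rightarrow> bool" where
  "hunt_expandable M F f \<longleftrightarrow>
     (\<exists>X. deterministic_hunt M F X \<and> (\<forall>t\<ge>0. X (f 0) t = f t))"

definition ito_expandable ::
    "'w measure \<Rightarrow> (real \<Rightarrow> 'w measure) \<Rightarrow> (real^'d \<Rightarrow> real^'d) \<Rightarrow> (real \<Rightarrow> real^'d) \<Rightarrow> bool" where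
  "ito_expandable M F h f \<longleftrightarrow>
     (\<exists>X. deterministic_ito M F h X \<and> (\<forall>t\<ge>0. X (f 0) t = f t))"

end

theory Submission
  imports Defs
begin

text \<open>
  If \<open>X\<close> is a deterministic Ito process, then the number of jumps of \<open>X x\<close> up to time \<open>u\<close> that are
  larger than \<open>\<epsilon>\<close> equals a Lebesgue integral over \<open>[0, u]\<close>, so it is continuous in \<open>u\<close> and hence
  \<open>0\<close>.  The path is therefore continuous, and its difference from \<open>x + B\<close> is a deterministic local
  martingale null at \<open>0\<close>, which vanishes.

  Conversely, extend \<open>f\<close> to the flow that moves points on the range of \<open>f\<close> along \<open>f\<close> and leaves all
  other points fixed.  It is Borel measurable in the starting point because the range of \<open>f\<close> is
  \<open>\<sigma>\<close>-compact, so its right derivative at time \<open>0\<close> is a Borel drift, and \<open>Q = 0\<close>, \<open>N = 0\<close>.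
\<close>

section \<open>Single paths: limits, jumps, and the effect of continuity\<close>

section \<open>Continuous and absolutely continuous paths\<close>

lemma isCont_if_continuous_on_atLeast:
  fixes g :: "real \<Rightarrow> 'a::topological_space"
  assumes "continuous_on {0..} g" and "t > 0"
  shows "isCont g t"
  using continuous_on_interior[OF assms(1)] assms(2) by (simp add: interior_real_atLeast)

lemma cadlag_if_continuous_on:
  fixes g :: "real \<Rightarrow> 'a::t2_space"
  assumes "continuous_on {0..} g"
  shows "cadlag g"
  unfolding cadlag_def
proof (intro conjI allI impI)
  fix t :: real assume "t \<ge> 0"
  then have "(g \<longlongrightarrow> g t) (at t within {0..})"
    using assms by (simp add: continuous_on)
  then show "(g \<longlongrightarrow> g t) (at_right t)"
    by (rule tendsto_within_subset) (use \<open>t \<ge> 0\<close> in auto)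
next
  fix t :: real assume "t > 0"
  with isCont_if_continuous_on_atLeast[OF assms] have "(g \<longlongrightarrow> g t) (at t)"
    by (simp add: isCont_def)
  then show "\<exists>l. (g \<longlongrightarrow> l) (at_left t)"
    using filterlim_at_split by blast
qed

lemma jump_eq_0_if_continuous_on:
  fixes g :: "real \<Rightarrow> 'a::real_normed_vector"
  assumes "continuous_on {0..} g"
  shows "jump g t = 0"
proof (cases "t > 0")
  case True
  with isCont_if_continuous_on_atLeast[OF assms] have "(g \<longlongrightarrow> g t) (at_left t)"
    by (auto simp: isCont_def filterlim_at_split)
  then show ?thesis
    by (simp add: jump_def tendsto_Lim)
qed (simp add: jump_def)

text \<open>A cadlag path already has a left limit at each positive time; a zero jump identifies it
  with the value. At time 0 only the right limit matters.\<close>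

lemma continuous_on_if_jump_eq_0:
  fixes g :: "real \<Rightarrow> 'a::real_normed_vector"
  assumes "cadlag g" and "\<And>t. t > 0 \<Longrightarrow> jump g t = 0"
  shows "continuous_on {0..} g"
  unfolding continuous_on
proof
  fix t :: real assume "t \<in> {0..}"
  then have right: "(g \<longlongrightarrow> g t) (at_right t)"
    using assms(1) by (simp add: cadlag_def)
  show "(g \<longlongrightarrow> g t) (at t within {0..})"
  proof (cases "t > 0")
    case True
    then obtain l where l: "(g \<longlongrightarrow> l) (at_left t)"
      using assms(1) by (auto simp: cadlag_def)
    then have "l = g t"
      using assms(2)[OF True] True by (simp add: jump_def tendsto_Lim)
    with l right have "(g \<longlongrightarrow> g t) (at t)"
      by (simp add: filterlim_at_split)
    then show ?thesis
      by (rule tendsto_mono[rotated]) (simp add: at_le)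
  next
    case False
    with \<open>t \<in> {0..}\<close> have "t = 0" by simp
    with right show ?thesis
      by (simp add: at_within_Ici_at_right)
  qed
qed

text \<open>Since \<open>h\<close> is the identity near 0, it fixes 0; with all jumps zero, the
  index set of the correction sum is empty.\<close>

lemma remove_big_jumps_continuous_on:
  assumes "continuous_on {0..} g" and "truncation_function h"
  shows "remove_big_jumps h g t = g t"
proof -
  have "h 0 = 0"
    using assms(2) by (auto simp: truncation_function_def)
  then show ?thesis
    using jump_eq_0_if_continuous_on[OF assms(1)] by (simp add: remove_big_jumps_def)
qed

lemma jump_measure_continuous_on:
  fixes g :: "real \<Rightarrow> 'v::real_normed_vector"
  assumes "continuous_on {0..} g"
  shows "jump_measure g = null_measure time_mark_space"
  unfolding jump_measure_def
  by (rule measure_eqI)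
     (auto simp: emeasure_distr jump_eq_0_if_continuous_on[OF assms])

section \<open>Paths that are integrals of a density\<close>

text \<open>Translates the Lebesgue density of the definition into gauge integrals, for which
  additivity over adjacent intervals is convenient.\<close>

lemma abs_continuousE:
  assumes "abs_continuous g"
  obtains b where
    "\<And>t. 0 \<le> t \<Longrightarrow> set_integrable lborel {0..t} b"
    "\<And>u v. 0 \<le> u \<Longrightarrow> b integrable_on {u..v}"
    "\<And>u v. 0 \<le> u \<Longrightarrow> (\<lambda>s. \<bar>b s\<bar>) integrable_on {u..v}"
    "\<And>u v. 0 \<le> u \<Longrightarrow> u \<le> v \<Longrightarrow> g v - g u = integral {u..v} b"
    "\<And>t. 0 \<le> t \<Longrightarrow> g t = integral {0..t} b"
proof -
  from assms obtain b where b: "\<And>t. 0 \<le> t \<Longrightarrow> set_integrable lborel {0..t} b"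
    and g: "\<And>t. 0 \<le> t \<Longrightarrow> g t = (LINT s:{0..t}|lborel. b s)"
    unfolding abs_continuous_def by blast
  have sub: "f integrable_on {u..v}" if "\<And>t. 0 \<le> t \<Longrightarrow> set_integrable lborel {0..t} f" "0 \<le> u"
    for f :: "real \<Rightarrow> real" and u v
  proof (cases "u \<le> v")
    case True
    then have "f integrable_on {0..v}"
      using set_borel_integral_eq_integral(1)[OF that(1)] that(2) by auto
    then show ?thesis
      by (rule integrable_on_subinterval) (use that in auto)
  qed (simp add: integrable_on_empty)
  have 1: "g t = integral {0..t} b" if "0 \<le> t" for t
    using g[OF that] set_borel_integral_eq_integral(2)[OF b[OF that]] by simp
  have 2: "g v - g u = integral {u..v} b" if "0 \<le> u" "u \<le> v" for u v
    using Henstock_Kurzweil_Integration.integral_combine[of 0 u v b] that 1[of u] 1[of v]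
      sub[of b 0 v] b by simp
  show thesis
    by (rule that[of b]) (use b 1 2 sub[of b] sub[of "\<lambda>s. \<bar>b s\<bar>", OF set_integrable_abs[OF b]] in auto)
qed

lemma abs_continuous_imp_continuous_on:
  assumes "abs_continuous g"
  shows "continuous_on {0..} g"
proof -
  obtain b where b: "\<And>u v. 0 \<le> u \<Longrightarrow> b integrable_on {u..v}"
    and g: "\<And>t. 0 \<le> t \<Longrightarrow> g t = integral {0..t} b"
    using abs_continuousE[OF assms] by metis
  have "continuous (at t within {0..}) g" if "t \<ge> 0" for t
  proof -
    \<comment> \<open>The endpoint \<open>t+1\<close> leaves room to the right of \<open>t\<close>,
      so this interval and the half line have the same punctured neighbourhoods at
      \<open>t\<close>.\<close>
    have "continuous_on {0..t+1} (\<lambda>t. integral {0..t} b)"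
      by (rule indefinite_integral_continuous_1) (use b in auto)
    then have "continuous_on {0..t+1} g"
      by (rule continuous_on_eq) (use g in auto)
    then have "continuous (at t within {0..t+1}) g"
      using that by (auto simp: continuous_on_eq_continuous_within)
    moreover have "at t within {0..} = at t within {0..t+1}"
      by (rule at_within_nhd[of t "{..<t+1}"]) auto
    ultimately show ?thesis by simp
  qed
  then show ?thesis
    by (simp add: continuous_on_eq_continuous_within)
qed

lemma abs_continuous_0: "abs_continuous g \<Longrightarrow> g 0 = 0"
  by (erule abs_continuousE) simp

text \<open>Each increment is dominated by that of the monotone function \<open>G\<close>, the
  integral of \<open>\<bar>b\<bar>\<close>; along any partition the increments of \<open>G\<close>
  telescope.\<close>

lemma abs_continuous_imp_finite_variation:
  assumes "abs_continuous g"
  shows "finite_variation g"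
proof -
  obtain b where b: "\<And>u v. 0 \<le> u \<Longrightarrow> b integrable_on {u..v}"
    and b': "\<And>u v. 0 \<le> u \<Longrightarrow> (\<lambda>s. \<bar>b s\<bar>) integrable_on {u..v}"
    and g: "\<And>u v. 0 \<le> u \<Longrightarrow> u \<le> v \<Longrightarrow> g v - g u = integral {u..v} b"
    using abs_continuousE[OF assms] by metis
  define G where "G t = integral {0..t} (\<lambda>s. \<bar>b s\<bar>)" for t
  have G: "G v - G u = integral {u..v} (\<lambda>s. \<bar>b s\<bar>)" if "0 \<le> u" "u \<le> v" for u v
    using Henstock_Kurzweil_Integration.integral_combine[of 0 u v "\<lambda>s. \<bar>b s\<bar>"] that b'[of 0 v]
    by (simp add: G_def)
  have G_mono: "G u \<le> G v" if "0 \<le> u" "u \<le> v" for u v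
    using G[OF that] Henstock_Kurzweil_Integration.integral_nonneg[OF b'[of u v]] that by simp
  have gG: "\<bar>g v - g u\<bar> \<le> G v - G u" if "0 \<le> u" "u \<le> v" for u v
    unfolding G[OF that] g[OF that]
    using integral_norm_bound_integral[of b "{u..v}" "\<lambda>s. \<bar>b s\<bar>"] b[of u v] b'[of u v] that by simp
  have "(\<Sum>i<n. \<bar>g (p (Suc i)) - g (p i)\<bar>) \<le> G t" if p: "mono p" "range p \<subseteq> {0..t}" for n p t
  proof -
    have p0: "0 \<le> p i" "p i \<le> t" for i
      using p(2) by (auto simp: image_subset_iff)
    have "(\<Sum>i<n. \<bar>g (p (Suc i)) - g (p i)\<bar>) \<le> (\<Sum>i<n. G (p (Suc i)) - G (p i))"
      by (intro sum_mono gG) (use p p0 in \<open>auto simp: mono_iff_le_Suc\<close>)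
    also have "\<dots> = G (p n) - G (p 0)"
      by (rule sum_lessThan_telescope)
    also have "\<dots> \<le> G t"
      using G_mono[of "p n" t] G_mono[of 0 "p 0"] p0[of 0] p0[of n] by (simp add: G_def)
    finally show ?thesis .
  qed
  then show ?thesis
    unfolding finite_variation_def by blast
qed

text \<open>The translated density serves. This covers a flow path that joins \<open>f\<close> at a
  later time.\<close>

lemma abs_continuous_shift:
  assumes "abs_continuous g" and "0 \<le> r"
  shows "abs_continuous (\<lambda>t. g (r + t) - g r)"
proof -
  obtain b where b: "\<And>t. 0 \<le> t \<Longrightarrow> set_integrable lborel {0..t} b"
    and g: "\<And>u v. 0 \<le> u \<Longrightarrow> u \<le> v \<Longrightarrow> g v - g u = integral {u..v} b"
    using abs_continuousE[OF assms(1)] by metis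
  have "set_integrable lborel {0..t} (\<lambda>s. b (r + s)) \<and>
      g (r + t) - g r = (LINT s:{0..t}|lborel. b (r + s))" if "t \<ge> 0" for t
  proof
    have ind: "indicator {r..r+t} (r + s) = (indicator {0..t} s :: real)" for s
      by (auto simp: indicator_def)
    have int: "set_integrable lborel {r..r+t} b"
      by (rule set_integrable_subset[OF b[of "r + t"]]) (use that assms(2) in auto)
    show "set_integrable lborel {0..t} (\<lambda>s. b (r + s))"
      using lborel_integrable_real_affine[of "\<lambda>x. indicator {r..r+t} x *\<^sub>R b x" 1 r] int
      by (simp add: set_integrable_def ind)
    have "g (r + t) - g r = (LINT s:{r..r+t}|lborel. b s)"
      using g[of r "r + t"] set_borel_integral_eq_integral(2)[OF int] that assms(2) by simp
    also have "\<dots> = (LINT s:{0..t}|lborel. b (r + s))"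
      using lborel_integral_real_affine[of 1 "\<lambda>x. indicator {r..r+t} x *\<^sub>R b x" r]
      by (simp add: set_lebesgue_integral_def ind)
    finally show "g (r + t) - g r = (LINT s:{0..t}|lborel. b (r + s))" .
  qed
  then show ?thesis
    unfolding abs_continuous_def by blast
qed

lemma abs_continuous_zero: "abs_continuous (\<lambda>_. 0)"
  unfolding abs_continuous_def by (rule exI[of _ "\<lambda>_. 0"]) (simp add: set_integrable_def)

text \<open>Lebesgue differentiation along the steps 1/(n+1). A sequence of difference quotients,
  instead of a continuous limit, later yields a measurable drift.\<close>

lemma abs_continuous_AE_derivative:
  assumes "abs_continuous g"
  obtains b where
    "\<And>t. 0 \<le> t \<Longrightarrow> set_integrable lborel {0..t} b"
    "\<And>t. 0 \<le> t \<Longrightarrow> g t = (LINT s:{0..t}|lborel. b s)"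
    "AE s in lborel. 0 \<le> s \<longrightarrow>
       (\<lambda>n. real (Suc n) * (g (s + 1 / real (Suc n)) - g s)) \<longlonglongrightarrow> b s"
proof -
  obtain b where b: "\<And>t. 0 \<le> t \<Longrightarrow> set_integrable lborel {0..t} b"
    and int: "\<And>u v. 0 \<le> u \<Longrightarrow> b integrable_on {u..v}"
    and g: "\<And>u v. 0 \<le> u \<Longrightarrow> u \<le> v \<Longrightarrow> g v - g u = integral {u..v} b"
    and g0: "\<And>t. 0 \<le> t \<Longrightarrow> g t = integral {0..t} b"
    using abs_continuousE[OF assms] by metis
  \<comment> \<open>The density is controlled only at nonnegative times, while the differentiation
    theorem asks for integrability on every interval; hence the extension by 0. Only increments to
    the right are used, so the cut at 0 does no harm.\<close>
  define b0 where "b0 s = (if s \<in> {0..} then b s else 0)" for s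
  have "b0 integrable_on cbox u v" for u v
  proof -
    have "b integrable_on {0..v}"
      by (rule int) simp
    then have "(\<lambda>s. if s \<in> {0..v} then b s else 0) integrable_on UNIV"
      by (simp only: integrable_restrict_UNIV)
    then have "(\<lambda>s. if s \<in> {0..v} then b s else 0) integrable_on cbox u v"
      by (rule integrable_on_subcbox) simp
    then show ?thesis
      by (rule integrable_eq) (auto simp: b0_def)
  qed
  then obtain N where N: "negligible N"
    and lim: "\<And>x e. \<lbrakk>x \<notin> N; 0 < e\<rbrakk> \<Longrightarrow>
               \<exists>d>0. \<forall>h. 0 < h \<and> h < d \<longrightarrow>
                         norm (integral (cbox x (x + h *\<^sub>R One)) b0 /\<^sub>R h ^ DIM(real) - b0 x) < e"
    using integrable_ccontinuous_explicit by metis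
  have conv: "(\<lambda>n. real (Suc n) * (g (s + 1 / real (Suc n)) - g s)) \<longlonglongrightarrow> b s"
    if s: "s \<notin> N" "0 \<le> s" for s
  proof (rule LIMSEQ_I)
    fix e :: real assume "e > 0"
    then obtain d where d: "d > 0"
      and *: "\<And>h. 0 < h \<Longrightarrow> h < d \<Longrightarrow> \<bar>integral {s..s + h} b0 / h - b0 s\<bar> < e"
      using lim[OF s(1)] by (force simp: divide_inverse mult.commute)
    obtain n0 where n0: "inverse (real (Suc n0)) < d"
      using reals_Archimedean[OF d] by blast
    show "\<exists>no. \<forall>n\<ge>no. norm (real (Suc n) * (g (s + 1 / real (Suc n)) - g s) - b s) < e"
    proof (intro exI[of _ n0] allI impI)
      fix n assume "n0 \<le> n"
      define h where "h = 1 / real (Suc n)"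
      have h: "h > 0" "h < d"
        using n0 \<open>n0 \<le> n\<close> le_imp_inverse_le[of "real (Suc n0)" "real (Suc n)"]
        by (auto simp: h_def inverse_eq_divide)
      have "integral {s..s + h} b0 = integral {s..s + h} b"
        by (rule integral_cong) (use s in \<open>simp add: b0_def\<close>)
      also have "\<dots> = g (s + h) - g s"
        using g[of s "s + h"] h s by simp
      finally have "integral {s..s + h} b0 / h = real (Suc n) * (g (s + h) - g s)"
        by (simp add: h_def)
      then show "norm (real (Suc n) * (g (s + 1 / real (Suc n)) - g s) - b s) < e"
        using *[OF h] s by (simp add: b0_def h_def mult.commute)
    qed
  qed
  \<comment> \<open>Negligible sets are null for the completed measure; such sets have Borel null
    covers, which brings the statement back to \<open>lborel\<close>.\<close>
  have "AE s in lebesgue. s \<notin> N"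
    using N by (simp add: negligible_iff_null_sets AE_not_in)
  then have "AE s in lborel. s \<notin> N"
    by (simp add: AE_completion_iff)
  then have "AE s in lborel. 0 \<le> s \<longrightarrow>
       (\<lambda>n. real (Suc n) * (g (s + 1 / real (Suc n)) - g s)) \<longlonglongrightarrow> b s"
    by eventually_elim (use conv in blast)
  moreover have "g t = (LINT s:{0..t}|lborel. b s)" if "0 \<le> t" for t
    using g0[OF that] set_borel_integral_eq_integral(2)[OF b[OF that]] by simp
  ultimately show thesis
    using that b by blast
qed

section \<open>Sufficiency: characteristics of processes whose paths have densities\<close>

section \<open>Deterministic processes with absolutely continuous paths\<close>

lemma martingale_zero:
  assumes "stochastic_basis M F"
  shows "martingale M F (\<lambda>t \<omega>. 0)"
proof -
  have "AE \<omega> in M. real_cond_exp M (F s) (\<lambda>\<omega>. 0) \<omega> = 0" for s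
  proof -
    from assms interpret prob_space M
      by (simp add: stochastic_basis_def)
    interpret finite_measure_subalgebra M "F s"
      by unfold_locales (use assms in \<open>simp add: stochastic_basis_def\<close>)
    show ?thesis
      by (rule real_cond_exp_F_meas) auto
  qed
  then show ?thesis
    by (simp add: martingale_def cadlag_if_continuous_on)
qed

text \<open>The zero process will be the martingale part, its continuous component and its purely
  discontinuous component for a deterministic path of finite variation.\<close>

lemma null_local_martingale_zero:
  assumes "stochastic_basis M F"
  shows "null_local_martingale M F (\<lambda>t \<omega>. 0)"
  unfolding null_local_martingale_def local_martingale_def
  using martingale_zero[OF assms]
  by (auto intro!: exI[of _ "\<lambda>n _. real n"] stopping_time_const filterlim_real_sequentially)

section \<open>Predictability of deterministic processes\<close>

lemma space_predictable_space:
  assumes "stochastic_basis M F"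
  shows "space (predictable_space M F) = {0..} \<times> space M"
proof -
  have "space (F t) = space M" for t
    using assms by (simp add: stochastic_basis_def subalgebra_def)
  then show ?thesis
    unfolding predictable_space_def
    by (intro space_measure_of) (auto dest: sets.sets_into_space)
qed

text \<open>A deterministic process factors through the time coordinate, so its predictability
  reduces to that of this projection.\<close>

lemma measurable_fst_predictable_space:
  assumes "stochastic_basis M F"
  shows "fst \<in> borel_measurable (predictable_space M F)"
  unfolding borel_measurable_iff_le
proof
  fix a :: real
  have sp: "space (F t) = space M" for t
    using assms by (simp add: stochastic_basis_def subalgebra_def)
  have *: "sets (predictable_space M F) =
      sigma_sets ({0..} \<times> space M) ({{0} \<times> A | A. A \<in> sets (F 0)} \<union>
        {{s<..t} \<times> A | s t A. 0 \<le> s \<and> s \<le> t \<and> A \<in> sets (F s)})"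
    unfolding predictable_space_def
    by (rule sets_measure_of) (use sp in \<open>auto dest: sets.sets_into_space\<close>)
  show "{w \<in> space (predictable_space M F). fst w \<le> a} \<in> sets (predictable_space M F)"
  proof (cases "a \<ge> 0")
    case True
    have "space M \<in> sets (F 0)"
      using sp by (metis sets.top)
    \<comment> \<open>The times up to \<open>a\<close> split into one generator of each kind; for
      \<open>a = 0\<close> the second is empty.\<close>
    then have "{0} \<times> space M \<in> sets (predictable_space M F)"
      "{0<..a} \<times> space M \<in> sets (predictable_space M F)"
      unfolding * using True by (blast intro: sigma_sets.Basic)+
    then have "{0} \<times> space M \<union> {0<..a} \<times> space M \<in> sets (predictable_space M F)"
      by (rule sets.Un)
    also have "{0} \<times> space M \<union> {0<..a} \<times> space M = {w \<in> space (predictable_space M F). fst w \<le> a}"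
      using True by (auto simp: space_predictable_space[OF assms(1)])
    finally show ?thesis .
  next
    case False
    then have "{w \<in> space (predictable_space M F). fst w \<le> a} = {}"
      by (auto simp: space_predictable_space[OF assms(1)])
    then show ?thesis by (simp only: sets.empty_sets)
  qed
qed

lemma predictable_fv_process_abs_continuous:
  assumes "stochastic_basis M F" and "abs_continuous a"
  shows "predictable_fv_process M F (\<lambda>t \<omega>. a t)"
proof -
  note cont = abs_continuous_imp_continuous_on[OF assms(2)]
  have "fst \<in> measurable (predictable_space M F) (restrict_space borel {0..})"
    by (rule measurable_restrict_space2)
       (use assms(1) in \<open>auto simp: space_predictable_space[OF assms(1)] measurable_fst_predictable_space\<close>)
  then have "(\<lambda>w. a (fst w)) \<in> borel_measurable (predictable_space M F)"
    by (rule measurable_compose) (rule borel_measurable_continuous_on_restrict[OF cont])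
  then show ?thesis
    using cadlag_if_continuous_on[OF cont] abs_continuous_imp_finite_variation[OF assms(2)]
      abs_continuous_0[OF assms(2)]
    by (simp add: predictable_fv_process_def fv_process_def case_prod_unfold)
qed

lemma continuous_on_if_abs_continuous_components:
  fixes g :: "real \<Rightarrow> real^'d"
  assumes "\<And>j. abs_continuous (\<lambda>t. g t $ j - g 0 $ j)"
  shows "continuous_on {0..} g"
proof -
  have "continuous_on {0..} (\<lambda>t. \<chi> j. (g t $ j - g 0 $ j) + g 0 $ j)"
    by (intro continuous_on_vec_lambda continuous_on_add continuous_on_const
        abs_continuous_imp_continuous_on assms)
  then show ?thesis by simp
qed

text \<open>The path minus its starting value is itself the predictable finite variation part, all
  martingale parts are zero, and continuity removes both the big jumps and the jump measure.\<close>

lemma characteristics_deterministic: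
  fixes g :: "real \<Rightarrow> real^'d"
  assumes sb: "stochastic_basis M F" and h: "truncation_function h"
    and ac: "\<And>j. abs_continuous (\<lambda>t. g t $ j - g 0 $ j)"
  shows "characteristics M F h (\<lambda>t \<omega>. g t) (\<lambda>t \<omega>. g t - g 0) (\<lambda>t \<omega>. 0)
           (\<lambda>\<omega>. null_measure time_mark_space)"
proof -
  have cont: "continuous_on {0..} g"
    by (rule continuous_on_if_abs_continuous_components[OF ac])
  note zero = null_local_martingale_zero[OF sb]
  have fv: "predictable_fv_process M F (\<lambda>t \<omega>. g t $ j - g 0 $ j)" for j
    by (rule predictable_fv_process_abs_continuous[OF sb ac])
  then have fv': "fv_process M F (\<lambda>t \<omega>. g t $ j - g 0 $ j)" for j
    by (simp add: predictable_fv_process_def)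
  have semi: "semimartingale1 M F (\<lambda>t \<omega>. g t $ j)" for j
    unfolding semimartingale1_def
    using zero fv'[of j]
    by (intro conjI exI[of _ "\<lambda>t \<omega>. 0"] exI[of _ "\<lambda>t \<omega>. g t $ j - g 0 $ j"]) simp_all
  \<comment> \<open>The product with any continuous local martingale is again zero.\<close>
  have "purely_discontinuous M F (\<lambda>t \<omega>. 0)"
    using zero by (simp add: purely_discontinuous_def null_local_martingale_def)
  then have cmp: "continuous_martingale_part M F (\<lambda>t \<omega>. g t $ j) (\<lambda>t \<omega>. 0)" for j
    unfolding continuous_martingale_part_def continuous_null_local_martingale_def
    using zero fv'[of j]
    by (intro conjI exI[of _ "\<lambda>t \<omega>. 0"] exI[of _ "\<lambda>t \<omega>. g t $ j - g 0 $ j"]) simp_all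
  have cov: "predictable_covariation M F (\<lambda>t \<omega>. 0) (\<lambda>t \<omega>. 0) (\<lambda>t \<omega>. 0)"
    unfolding predictable_covariation_def
    using zero predictable_fv_process_abs_continuous[OF sb abs_continuous_zero]
    by (simp add: null_local_martingale_def)
  have "jump_compensator M F (\<lambda>t \<omega>. g t) (\<lambda>\<omega>. null_measure time_mark_space)"
    unfolding jump_compensator_def predictable_random_measure_def random_measure_integral_def
    by (simp add: jump_measure_continuous_on[OF cont])
  then show ?thesis
    unfolding characteristics_def semimartingale_def
    using semi fv zero cmp cov
    by (intro conjI exI[of _ "\<lambda>j t \<omega>. 0"]) (simp_all add: remove_big_jumps_continuous_on[OF cont h])
qed

text \<open>
  The drift is the right derivative of the flow at time \<open>0\<close>.  Along a path it agrees almost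
  everywhere with the density of that path, by the Markov property and Lebesgue's differentiation
  theorem.
\<close>

lemma deterministic_itoI:
  fixes Y :: "real^'d \<Rightarrow> real \<Rightarrow> real^'d"
  assumes sb: "stochastic_basis M F" and h: "truncation_function h"
    and markov: "deterministic_markov Y"
    and meas: "\<And>t. 0 \<le> t \<Longrightarrow> (\<lambda>x. Y x t) \<in> borel_measurable borel"
    and ac: "\<And>x j. abs_continuous (\<lambda>t. Y x t $ j - x $ j)"
  shows "deterministic_ito M F h Y"
proof -
  \<comment> \<open>Where the quotients diverge, \<open>lim\<close> still returns some value; the
    function stays Borel, and along each path this can happen only on a null set of times.\<close>
  define \<l> :: "real^'d \<Rightarrow> real^'d" where
    "\<l> x = (\<chi> j. lim (\<lambda>n. real (Suc n) * (Y x (1 / real (Suc n)) $ j - x $ j)))" for x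
  have Y0: "Y x 0 = x" for x
    using markov by (simp add: deterministic_markov_def)
  \<comment> \<open>The Markov property compares \<open>Y x\<close> at time \<open>s\<close> with
    the path restarted at \<open>Y x s\<close>, taken at time 0; this is the semigroup law.\<close>
  have flow: "Y (Y x s) t = Y x (s + t)" if "0 \<le> s" "0 \<le> t" for x s t
  proof -
    have "Y (Y x s) 0 = Y x s"
      by (rule Y0)
    then show ?thesis
      using markov that unfolding deterministic_markov_def by (metis add_0 order_refl)
  qed
  have ac': "abs_continuous (\<lambda>t. Y x t $ j - Y x 0 $ j)" for x j
    using ac Y0 by simp
  have cont: "continuous_on {0..} (Y x)" for x
    by (rule continuous_on_if_abs_continuous_components[OF ac'])
  have meas_\<l>: "(\<lambda>x. \<l> x $ j) \<in> borel_measurable borel" for j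
  proof -
    have [measurable]: "(\<lambda>x. Y x (1 / real (Suc n))) \<in> borel_measurable borel" for n
      by (rule meas) simp
    have [measurable]: "(\<lambda>x :: real^'d. x $ j) \<in> borel_measurable borel"
      by (intro borel_measurable_continuous_onI continuous_intros)
    have "(\<lambda>x. lim (\<lambda>n. real (Suc n) * (Y x (1 / real (Suc n)) $ j - x $ j))) \<in> borel_measurable borel"
      by measurable
    then show ?thesis by (simp add: \<l>_def)
  qed
  have drift: "set_integrable lborel {0..t} (\<lambda>s. \<l> (Y x s) $ j) \<and>
      Y x t $ j - x $ j = (LINT s:{0..t}|lborel. \<l> (Y x s) $ j)" if "t \<ge> 0" for x j t
  proof -
    obtain b where b: "\<And>t. 0 \<le> t \<Longrightarrow> set_integrable lborel {0..t} b"
      and g: "\<And>t. 0 \<le> t \<Longrightarrow> Y x t $ j - x $ j = (LINT s:{0..t}|lborel. b s)"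
      and lim: "AE s in lborel. 0 \<le> s \<longrightarrow> (\<lambda>n. real (Suc n) *
        ((Y x (s + 1 / real (Suc n)) $ j - x $ j) - (Y x s $ j - x $ j))) \<longlonglongrightarrow> b s"
      by (rule abs_continuous_AE_derivative[OF ac[of x j]]) (rule that)
    have AE: "AE s in lborel. indicator {0..t} s *\<^sub>R b s = indicator {0..t} s *\<^sub>R \<l> (Y x s) $ j"
      using lim
    proof eventually_elim
      case (elim s)
      show ?case
      proof (cases "0 \<le> s")
        case True
        with elim have "(\<lambda>n. real (Suc n) * (Y (Y x s) (1 / real (Suc n)) $ j - Y x s $ j)) \<longlonglongrightarrow> b s"
          by (simp add: flow)
        then have "\<l> (Y x s) $ j = b s"
          by (simp add: \<l>_def limI)
        then show ?thesis by simp
      qed (simp add: indicator_def)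
    qed
    \<comment> \<open>Borel measure is not complete, so almost everywhere equality with
      \<open>b\<close> transfers integrability only once the drift along the path is known to be
      measurable.\<close>
    have Z: "(\<lambda>s. Y x s) \<in> borel_measurable (restrict_space borel {0..})"
      by (rule borel_measurable_continuous_on_restrict[OF cont])
    have "(\<lambda>s. \<l> (Y x s) $ j) \<in> borel_measurable (restrict_space borel {0..})"
      using measurable_compose[OF Z meas_\<l>] .
    then have "(\<lambda>s. \<l> (Y x s) $ j) \<in> borel_measurable (restrict_space borel {0..t})"
      by (rule measurable_restrict_mono) auto
    then have m: "(\<lambda>s. indicator {0..t} s *\<^sub>R \<l> (Y x s) $ j) \<in> borel_measurable lborel"
      by (subst (asm) borel_measurable_restrict_space_iff) auto
    have "integrable lborel (\<lambda>s. indicator {0..t} s *\<^sub>R b s)"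
      using b[OF that] by (simp add: set_integrable_def)
    with m AE have "integrable lborel (\<lambda>s. indicator {0..t} s *\<^sub>R \<l> (Y x s) $ j)"
      "(\<integral>s. indicator {0..t} s *\<^sub>R b s \<partial>lborel) = (\<integral>s. indicator {0..t} s *\<^sub>R \<l> (Y x s) $ j \<partial>lborel)"
      by (auto intro: integrable_cong_AE_imp integral_cong_AE)
    then show ?thesis
      using g[OF that] by (simp add: set_integrable_def set_lebesgue_integral_def)
  qed
  have psd: "positive_semidefinite (0 :: real^'d^'d)"
    by (simp add: positive_semidefinite_def transpose_def vec_eq_iff)
  have tk: "transition_kernel (\<lambda>_ :: real^'d. null_measure mark_space)"
    by (simp add: transition_kernel_def)
  have "characteristics M F h (\<lambda>t \<omega>. Y x t) (\<lambda>t \<omega>. Y x t - x) (\<lambda>t \<omega>. 0)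
           (\<lambda>\<omega>. null_measure time_mark_space)" for x
    using characteristics_deterministic[OF sb h ac'] by (simp add: Y0)
  then have "\<exists>B C \<nu>. characteristics M F h (\<lambda>t \<omega>. Y x t) B C \<nu> \<and>
           (AE \<omega> in M. \<forall>t\<ge>0.
              (\<forall>j. set_integrable lborel {0..t} (\<lambda>s. \<l> (Y x s) $ j) \<and>
                 B t \<omega> $ j = (LINT s:{0..t}|lborel. \<l> (Y x s) $ j)) \<and>
              (\<forall>j k. set_integrable lborel {0..t} (\<lambda>s. (0 :: real^'d^'d) $ j $ k) \<and>
                 C t \<omega> $ j $ k = (LINT s:{0..t}|lborel. (0 :: real^'d^'d) $ j $ k)) \<and>
              (\<forall>A\<in>sets mark_space.
                 emeasure (\<nu> \<omega>) ({0..t} \<times> A) =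
                   (\<integral>\<^sup>+s\<in>{0..t}. emeasure (null_measure mark_space :: (real^'d) measure) A \<partial>lborel)))" for x
    by (intro exI conjI) (use drift in \<open>auto simp: set_integrable_def\<close>)
  then have "ito_process M F h (\<lambda>x t \<omega>. Y x t)"
    unfolding ito_process_def
    using meas_\<l> psd tk
    by (intro exI[of _ \<l>] exI[of _ "\<lambda>_. 0"] exI[of _ "\<lambda>_. null_measure mark_space"]) auto
  then show ?thesis
    using markov by (simp add: deterministic_ito_def)
qed

section \<open>Sufficiency: extending one path to a Borel measurable flow\<close>

section \<open>The flow generated by a single path\<close>

text \<open>\<open>SOME\<close> picks an arbitrary visiting time of \<open>x\<close>. For a
  self-consistent path the choice does not affect the result, as \<open>path_flow_on\<close>
  shows.\<close>

definition path_flow :: "(real \<Rightarrow> 'a) \<Rightarrow> 'a \<Rightarrow> real \<Rightarrow> 'a" where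
  "path_flow f x t =
     (if \<exists>s\<ge>0. f s = x then f ((SOME s. 0 \<le> s \<and> f s = x) + t) else x)"

text \<open>This is the Markov property applied to one path against itself.\<close>

locale self_consistent_path =
  fixes f :: "real \<Rightarrow> 'a"
  assumes self_consistent:
    "\<lbrakk>0 \<le> s; 0 \<le> t; 0 \<le> h; f s = f t\<rbrakk> \<Longrightarrow> f (s + h) = f (t + h)"
begin

lemma path_flow_on: "0 \<le> s \<Longrightarrow> 0 \<le> t \<Longrightarrow> path_flow f (f s) t = f (s + t)"
proof -
  assume "0 \<le> s" "0 \<le> t"
  define r where "r = (SOME r. 0 \<le> r \<and> f r = f s)"
  have "0 \<le> r \<and> f r = f s"
    unfolding r_def by (rule someI[of _ s]) (use \<open>0 \<le> s\<close> in simp)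
  then have "f (r + t) = f (s + t)"
    using \<open>0 \<le> s\<close> \<open>0 \<le> t\<close> by (intro self_consistent) auto
  then show ?thesis
    using \<open>0 \<le> s\<close> by (auto simp: path_flow_def r_def)
qed

lemma path_flow_off: "x \<notin> f ` {0..} \<Longrightarrow> path_flow f x t = x"
  by (auto simp: path_flow_def image_iff)

end

locale continuous_self_consistent_path = self_consistent_path f
  for f :: "real \<Rightarrow> 'a::metric_space" +
  assumes continuous_f: "continuous_on {0..} f"
begin

lemma deterministic_markov_path_flow: "deterministic_markov (path_flow f)"
  unfolding deterministic_markov_def
proof (intro conjI allI impI)
  fix x
  show "path_flow f x 0 = x"
    using path_flow_on[of _ 0] path_flow_off[of x] by (cases "x \<in> f ` {0..}") auto
  have "continuous_on {0..} (path_flow f x)"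
  proof (cases "x \<in> f ` {0..}")
    case True
    then obtain r where r: "x = f r" "r \<ge> 0" by auto
    have "continuous_on {0..} (\<lambda>t. f (r + t))"
      by (rule continuous_on_compose2[OF continuous_f]) (use r in \<open>auto intro!: continuous_intros\<close>)
    then show ?thesis
      by (rule continuous_on_eq) (use r path_flow_on in auto)
  next
    case False
    then have "path_flow f x = (\<lambda>_. x)"
      using path_flow_off by blast
    then show ?thesis by simp
  qed
  then show "cadlag (path_flow f x)"
    by (rule cadlag_if_continuous_on)
next
  fix x y and s t h :: real
  assume st: "0 \<le> s" "0 \<le> t" and eq: "path_flow f x s = path_flow f y t" and h: "0 \<le> h"
  \<comment> \<open>The range of \<open>f\<close> and its complement are both invariant, so two flow
    paths that meet start in the same part.\<close>
  have in_range: "path_flow f x s \<in> f ` {0..} \<longleftrightarrow> x \<in> f ` {0..}" if "0 \<le> s" for x s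
    using path_flow_on[OF _ that] path_flow_off[of x s] that by (cases "x \<in> f ` {0..}") auto
  show "path_flow f x (s + h) = path_flow f y (t + h)"
  proof (cases "x \<in> f ` {0..}")
    case True
    with in_range[OF st(1), of x] in_range[OF st(2), of y] eq have "y \<in> f ` {0..}"
      by simp
    with True obtain a b where ab: "x = f a" "0 \<le> a" "y = f b" "0 \<le> b"
      by auto
    with eq st have "f (a + s) = f (b + t)"
      by (simp add: path_flow_on)
    then have "f (a + s + h) = f (b + t + h)"
      by (intro self_consistent) (use ab st h in auto)
    then show ?thesis
      using ab st h by (simp add: path_flow_on add.assoc)
  next
    case False
    with in_range[OF st(1), of x] in_range[OF st(2), of y] eq have "y \<notin> f ` {0..}"
      by simp
    with False eq show ?thesis
      by (simp add: path_flow_off)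
  qed
qed

text \<open>For closed \<open>C\<close>, the preimage is \<open>C\<close> off the range of
  \<open>f\<close>, together with the image under \<open>f\<close> of the times \<open>s\<close>
  with \<open>f (s + t)\<close> in \<open>C\<close>. Both pieces are Borel because continuous images
  of compact sets are compact.\<close>

lemma borel_measurable_path_flow:
  assumes "0 \<le> t"
  shows "(\<lambda>x. path_flow f x t) \<in> borel_measurable borel"
proof -
  have "(\<lambda>x. path_flow f x t) -` C \<in> sets borel" if C: "closed C" for C
  proof -
    have compact_image: "f ` K \<in> sets borel" if "compact K" "K \<subseteq> {0..}" for K
      using compact_continuous_image[OF continuous_on_subset[OF continuous_f that(2)] that(1)]
      by (simp add: borel_compact)
    \<comment> \<open>Cutting at \<open>n\<close> makes these closed sets of times compact; their
      union over \<open>n\<close> recovers all nonnegative times.\<close>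
    define K where "K n = {0..real n} \<inter> (\<lambda>s. f (s + t)) -` C" for n
    have "continuous_on {0..real n} (\<lambda>s. f (s + t))" for n
      by (rule continuous_on_compose2[OF continuous_f])
         (use assms in \<open>auto intro!: continuous_intros\<close>)
    then have "compact (K n)" for n
      unfolding K_def compact_eq_bounded_closed
      using continuous_closed_preimage[OF _ closed_atLeastAtMost C]
      by (auto intro: bounded_subset[OF bounded_closed_interval])
    then have 1: "f ` K n \<in> sets borel" for n
      by (rule compact_image) (auto simp: K_def)
    have "f ` {0..} = (\<Union>n. f ` {0..real n})"
      using real_arch_simple by fastforce
    moreover have "f ` {0..real n} \<in> sets borel" for n
      by (rule compact_image) auto
    ultimately have 2: "f ` {0..} \<in> sets borel"
      by auto
    have "(\<lambda>x. path_flow f x t) -` C = (C - f ` {0..}) \<union> (\<Union>n. f ` K n)" (is "?L = ?R")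
    proof (rule set_eqI)
      fix x
      show "x \<in> ?L \<longleftrightarrow> x \<in> ?R"
      proof (cases "x \<in> f ` {0..}")
        case True
        then obtain r where r: "x = f r" "0 \<le> r" by auto
        obtain n where n: "r \<le> real n"
          using real_arch_simple by blast
        have "x \<in> ?L \<longleftrightarrow> f (r + t) \<in> C"
          using r assms by (simp add: path_flow_on)
        moreover have "x \<in> f ` K n" if "f (r + t) \<in> C"
          using that r n by (auto simp: K_def)
        \<comment> \<open>The time \<open>s\<close> found in \<open>K m\<close> may differ from
          \<open>r\<close>, but both visit \<open>x\<close>, so self-consistency equates the
          continuations.\<close>
        moreover have "f (r + t) \<in> C" if "x \<in> f ` K m" for m
        proof -
          from that obtain s where s: "f s = f r" "0 \<le> s" "f (s + t) \<in> C"
            using r by (auto simp: K_def)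
          then have "f (s + t) = f (r + t)"
            using r assms by (intro self_consistent) auto
          with s show ?thesis by simp
        qed
        ultimately show ?thesis
          using True by blast
      next
        case False
        then have "x \<notin> f ` K n" for n
          by (auto simp: K_def)
        with False path_flow_off[OF False] show ?thesis
          by simp
      qed
    qed
    then show ?thesis
      using 1 2 C by auto
  qed
  then have "(\<lambda>x. path_flow f x t) \<in> measurable borel (sigma UNIV (Collect closed))"
    by (intro measurable_measure_of) auto
  then show ?thesis
    by (simp add: borel_eq_closed[symmetric])
qed

end

text \<open>Self-consistency of \<open>f\<close> is inherited from the Hunt process. The other paths
  of that process may lack densities, so \<open>path_flow\<close> replaces them: every path is now a
  shift of \<open>f\<close> or constant.\<close>

lemma ito_expandableI:
  fixes f :: "real \<Rightarrow> real^'d"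
  assumes sb: "stochastic_basis M F" and h: "truncation_function h"
    and hunt: "hunt_expandable M F f"
    and ac: "\<And>j. abs_continuous (\<lambda>t. f t $ j - f 0 $ j)"
  shows "ito_expandable M F h f"
proof -
  obtain X where X: "deterministic_markov X" "\<And>t. t \<ge> 0 \<Longrightarrow> X (f 0) t = f t"
    using hunt by (auto simp: hunt_expandable_def deterministic_hunt_def)
  interpret continuous_self_consistent_path f
  proof
    show "continuous_on {0..} f"
      by (rule continuous_on_if_abs_continuous_components[OF ac])
    fix s t h :: real assume "0 \<le> s" "0 \<le> t" "0 \<le> h" "f s = f t"
    then show "f (s + h) = f (t + h)"
      using X unfolding deterministic_markov_def by (metis add_nonneg_nonneg)
  qed
  have "abs_continuous (\<lambda>t. path_flow f x t $ j - x $ j)" for x j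
  proof (cases "x \<in> f ` {0..}")
    case True
    then obtain r where r: "x = f r" "r \<ge> 0" by auto
    have "abs_continuous (\<lambda>t. f (r + t) $ j - f r $ j)"
      using abs_continuous_shift[OF ac r(2), of j] by simp
    then show ?thesis
      using r by (simp add: abs_continuous_def path_flow_on)
  next
    case False
    then show ?thesis
      by (simp add: path_flow_off abs_continuous_zero)
  qed
  then have "deterministic_ito M F h (path_flow f)"
    by (intro deterministic_itoI sb h deterministic_markov_path_flow borel_measurable_path_flow)
  then show ?thesis
    unfolding ito_expandable_def using path_flow_on[of 0] by auto
qed

section \<open>Necessity: jumps and measurability of cadlag paths\<close>

section \<open>Cadlag paths\<close>

text \<open>The value at \<open>s\<close> and the left limit there both lie within
  \<open>\<epsilon> / 2\<close> of \<open>c\<close>.\<close>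

lemma norm_jump_le:
  fixes g :: "real \<Rightarrow> 'a::real_normed_vector"
  assumes "cadlag g" and p: "0 \<le> p" "p < s" "s < q"
    and near: "\<And>r. p < r \<Longrightarrow> r < q \<Longrightarrow> dist (g r) c < \<epsilon> / 2"
  shows "norm (jump g s) \<le> \<epsilon>"
proof -
  obtain l where l: "(g \<longlongrightarrow> l) (at_left s)"
    using assms(1) p unfolding cadlag_def by (meson le_less_trans)
  have "\<forall>\<^sub>F r in at_left s. r \<in> {p<..<s}"
    using p by (intro eventually_at_left_real) auto
  then have "\<forall>\<^sub>F r in at_left s. dist (g r) c \<le> \<epsilon> / 2"
    by eventually_elim (use near p in fastforce)
  then have "dist l c \<le> \<epsilon> / 2"
    using tendsto_upperbound[OF tendsto_dist[OF l tendsto_const]] by (metis trivial_limit_at_left_real)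
  moreover have "dist (g s) c < \<epsilon> / 2"
    using near p by simp
  moreover have "jump g s = g s - l"
    using l p by (simp add: jump_def tendsto_Lim)
  ultimately show ?thesis
    using dist_triangle2[of "g s" l c] by (simp add: dist_norm)
qed

text \<open>Infinitely many big jumps would accumulate at some \<open>a\<close>; but the right limit
  and the left limit at \<open>a\<close> each exclude big jumps on a one-sided punctured
  neighbourhood.\<close>

lemma finite_big_jumps:
  fixes g :: "real \<Rightarrow> 'a::real_normed_vector"
  assumes g: "cadlag g" and "\<epsilon> > 0"
  shows "finite {s. 0 < s \<and> s \<le> t \<and> \<epsilon> < norm (jump g s)}" (is "finite ?J")
proof (rule ccontr)
  assume inf: "infinite ?J"
  have "?J \<subseteq> {0..t}" by auto
  with inf obtain a where a: "a \<in> {0..t}" "a islimpt ?J"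
    using Heine_Borel_imp_Bolzano_Weierstrass[OF compact_Icc[of 0 t]] by blast
  have "(g \<longlongrightarrow> g a) (at_right a)"
    using g a by (simp add: cadlag_def)
  then have "\<forall>\<^sub>F r in at_right a. dist (g r) (g a) < \<epsilon> / 2"
    by (rule tendstoD) (use \<open>\<epsilon> > 0\<close> in simp)
  then obtain b where b: "b > a" "\<And>r. a < r \<Longrightarrow> r < b \<Longrightarrow> dist (g r) (g a) < \<epsilon> / 2"
    by (auto simp: eventually_at_right_field)
  then have right: "norm (jump g s) \<le> \<epsilon>" if "a < s" "s < b" for s
    using norm_jump_le[OF g _ that(1) that(2)] a by auto
  have "\<exists>c<a. \<forall>s. 0 < s \<and> c < s \<and> s < a \<longrightarrow> norm (jump g s) \<le> \<epsilon>"
  proof (cases "a > 0")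
    case True
    then obtain l where "(g \<longlongrightarrow> l) (at_left a)"
      using g by (auto simp: cadlag_def)
    then have "\<forall>\<^sub>F r in at_left a. dist (g r) l < \<epsilon> / 2"
      by (rule tendstoD) (use \<open>\<epsilon> > 0\<close> in simp)
    then obtain c where c: "c < a" "\<And>r. c < r \<Longrightarrow> r < a \<Longrightarrow> dist (g r) l < \<epsilon> / 2"
      by (auto simp: eventually_at_left_field)
    then have "norm (jump g s) \<le> \<epsilon>" if "0 < s" "c < s" "s < a" for s
      using norm_jump_le[OF g, of "max 0 c" s a l \<epsilon>] that by auto
    with c show ?thesis by blast
  next
    case False
    \<comment> \<open>Here \<open>a = 0\<close>, and no positive time lies to its left.\<close>
    then show ?thesis by (intro exI[of _ "a - 1"]) auto
  qed
  then obtain c where c: "c < a" "\<And>s. 0 < s \<Longrightarrow> c < s \<Longrightarrow> s < a \<Longrightarrow> norm (jump g s) \<le> \<epsilon>"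
    by blast
  obtain s where s: "s \<in> ?J" "s \<in> {c<..<b}" "s \<noteq> a"
    using islimptE[OF a(2), of "{c<..<b}"] b c by auto
  then show False
    using right[of s] c(2)[of s] by (cases "s < a") auto
qed

text \<open>Right continuity makes the path a pointwise limit of functions that sample it on a grid
  and hence take countably many values.\<close>

lemma borel_measurable_cadlag:
  fixes g :: "real \<Rightarrow> 'a::metric_space"
  assumes "cadlag g"
  shows "g \<in> borel_measurable (restrict_space borel {0..})"
proof (rule borel_measurable_LIMSEQ_metric)
  \<comment> \<open>Adding 1 to the floor puts the grid point strictly to the right of
    \<open>s\<close>, as convergence along \<open>at_right s\<close> demands.\<close>
  define u where "u n s = (real_of_int \<lfloor>real (Suc n) * s\<rfloor> + 1) / real (Suc n)" for n s
  have "(\<lambda>s. g (u n s)) \<in> borel_measurable borel" for n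
  proof -
    have "(\<lambda>s. \<lfloor>real (Suc n) * s\<rfloor>) \<in> measurable borel (count_space UNIV)"
      by measurable
    then have "(\<lambda>s. g ((real_of_int \<lfloor>real (Suc n) * s\<rfloor> + 1) / real (Suc n))) \<in> borel_measurable borel"
      by (rule measurable_compose[where g = "\<lambda>i. g ((real_of_int i + 1) / real (Suc n))"]) simp
    then show ?thesis by (simp add: u_def)
  qed
  then show "(\<lambda>s. g (u n s)) \<in> borel_measurable (restrict_space borel {0..})" for n
    by (rule measurable_restrict_space1)
  fix s :: real assume "s \<in> space (restrict_space borel {0..})"
  then have "s \<ge> 0" by simp
  have u: "s < u n s" "u n s \<le> s + 1 / real (Suc n)" for n
  proof -
    have "real (Suc n) * s < real_of_int \<lfloor>real (Suc n) * s\<rfloor> + 1"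
      "real_of_int \<lfloor>real (Suc n) * s\<rfloor> \<le> real (Suc n) * s"
      by linarith+
    then show "s < u n s" "u n s \<le> s + 1 / real (Suc n)"
      unfolding u_def
      by (simp_all add: pos_less_divide_eq pos_divide_le_eq distrib_left mult.commute del: of_nat_Suc)
  qed
  have "(\<lambda>n. u n s) \<longlonglongrightarrow> s"
  proof (rule real_tendsto_sandwich[OF _ _ tendsto_const])
    show "(\<lambda>n. s + 1 / real (Suc n)) \<longlonglongrightarrow> s"
      using LIMSEQ_inverse_real_of_nat_add[of s] by (simp add: inverse_eq_divide)
    show "\<forall>\<^sub>F n in sequentially. s \<le> u n s"
      using u(1) by (intro always_eventually allI less_imp_le)
    show "\<forall>\<^sub>F n in sequentially. u n s \<le> s + 1 / real (Suc n)"
      using u(2) by (intro always_eventually allI)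
  qed
  then have "filterlim (\<lambda>n. u n s) (at_right s) sequentially"
    using u by (simp add: filterlim_at less_imp_neq[symmetric])
  then show "(\<lambda>n. g (u n s)) \<longlonglongrightarrow> g s"
    using assms \<open>s \<ge> 0\<close> by (auto simp: cadlag_def intro: filterlim_compose)
qed

section \<open>Necessity: what martingales and compensators say about a deterministic path\<close>

section \<open>Deterministic local martingales and compensators\<close>

text \<open>Each stopped martingale has mean 0 at time \<open>t\<close>. Its values there are almost
  surely values of \<open>g\<close> on \<open>[0, t]\<close>, bounded by continuity, and they become
  \<open>g t\<close> once the possibly random \<open>T n\<close> exceeds \<open>t\<close>; dominated
  convergence gives the claim.\<close>

lemma null_local_martingale_deterministic:
  assumes sb: "stochastic_basis M F" and L: "null_local_martingale M F L"
    and det: "AE \<omega> in M. \<forall>t\<ge>0. L t \<omega> = g t"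
    and cont: "continuous_on {0..} g" and "t \<ge> 0"
  shows "g t = 0"
proof -
  from sb interpret prob_space M
    by (simp add: stochastic_basis_def)
  have sub: "subalgebra M (F s)" for s
    using sb by (simp add: stochastic_basis_def)
  from L obtain T :: "nat \<Rightarrow> 'a \<Rightarrow> real" where
    T_nonneg: "\<And>n \<omega>. \<omega> \<in> space M \<Longrightarrow> 0 \<le> T n \<omega>"
    and T_lim: "AE \<omega> in M. filterlim (\<lambda>n. T n \<omega>) at_top sequentially"
    and mart: "\<And>n. martingale M F (\<lambda>t \<omega>. L (min t (T n \<omega>)) \<omega>)"
    and L0: "\<And>\<omega>. \<omega> \<in> space M \<Longrightarrow> L 0 \<omega> = 0"
    unfolding null_local_martingale_def local_martingale_def by blast
  define Z where "Z n \<omega> = L (min t (T n \<omega>)) \<omega>" for n \<omega>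
  have int: "integrable M (Z n)" for n
    using mart[of n] \<open>t \<ge> 0\<close> unfolding martingale_def Z_def by blast
  have Z0: "integral\<^sup>L M (Z n) = 0" for n
  proof -
    interpret finite_measure_subalgebra M "F 0"
      by unfold_locales (rule sub)
    \<comment> \<open>Conditioning on time 0 returns the stopped process at 0, which is
      \<open>L 0\<close> because \<open>T n\<close> is nonnegative.\<close>
    have "AE \<omega> in M. real_cond_exp M (F 0) (Z n) \<omega> = L (min 0 (T n \<omega>)) \<omega>"
      using mart[of n] \<open>t \<ge> 0\<close> unfolding martingale_def Z_def by blast
    then have "AE \<omega> in M. real_cond_exp M (F 0) (Z n) \<omega> = 0"
      using AE_space by eventually_elim (use T_nonneg L0 in \<open>simp add: min_absorb1\<close>)
    then have "(\<integral>\<omega>. real_cond_exp M (F 0) (Z n) \<omega> \<partial>M) = (\<integral>\<omega>. 0 \<partial>M)"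
      by (intro integral_cong_AE) (auto intro: borel_measurable_cond_exp2)
    then show ?thesis
      using real_cond_exp_int(2)[OF int] by simp
  qed
  have "bounded (g ` {0..t})"
    using compact_continuous_image[OF continuous_on_subset[OF cont] compact_Icc[of 0 t]]
    by (auto intro: compact_imp_bounded)
  then obtain K where K: "\<And>s. 0 \<le> s \<Longrightarrow> s \<le> t \<Longrightarrow> \<bar>g s\<bar> \<le> K"
    by (force simp: bounded_iff)
  have "(\<lambda>n. integral\<^sup>L M (Z n)) \<longlonglongrightarrow> (\<integral>\<omega>. g t \<partial>M)"
  proof (rule integral_dominated_convergence[where w = "\<lambda>_. K"])
    show "AE \<omega> in M. (\<lambda>n. Z n \<omega>) \<longlonglongrightarrow> g t"
      using det T_lim
    proof eventually_elim
      case (elim \<omega>)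
      from elim(2) have "\<forall>\<^sub>F n in sequentially. t \<le> T n \<omega>"
        by (simp add: filterlim_at_top)
      then have "\<forall>\<^sub>F n in sequentially. Z n \<omega> = g t"
        by eventually_elim (use elim(1) \<open>t \<ge> 0\<close> in \<open>simp add: Z_def\<close>)
      then show ?case
        by (rule tendsto_eventually)
    qed
    show "AE \<omega> in M. norm (Z n \<omega>) \<le> K" for n
      using det AE_space
      by eventually_elim (use T_nonneg \<open>t \<ge> 0\<close> K in \<open>simp add: Z_def\<close>)
  qed (use int in auto)
  then have "(\<lambda>n. 0) \<longlonglongrightarrow> g t"
    by (simp add: Z0 prob_space)
  then show ?thesis
    by (simp add: LIMSEQ_const_iff)
qed

lemma sets_time_mark_space_Times:
  assumes "B \<in> sets borel" "B \<subseteq> {0..}" "A \<in> sets mark_space"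
  shows "B \<times> A \<in> sets time_mark_space"
  unfolding time_mark_space_def
  using assms by (intro pair_measureI) (auto simp: sets_restrict_space)

lemma emeasure_jump_measure:
  fixes g :: "real \<Rightarrow> 'v::real_normed_vector"
  assumes A: "A \<in> sets mark_space"
  shows "emeasure (jump_measure g) ({0..u} \<times> A) =
    emeasure (count_space UNIV) {s. 0 < s \<and> s \<le> u \<and> jump g s \<in> A}"
proof -
  let ?J = "{s. 0 < s \<and> jump g s \<noteq> 0}"
  have A0: "A \<subseteq> - {0}"
    using sets.sets_into_space[OF A] by (auto simp: mark_space_def space_restrict_space)
  have "(\<lambda>s. (s, jump g s)) \<in> measurable (count_space ?J) time_mark_space"
    by (auto simp: time_mark_space_def mark_space_def space_pair_measure space_restrict_space)
  then have "emeasure (jump_measure g) ({0..u} \<times> A) =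
      emeasure (count_space ?J) ((\<lambda>s. (s, jump g s)) -` ({0..u} \<times> A) \<inter> ?J)"
    unfolding jump_measure_def
    by (subst emeasure_distr) (use A in \<open>auto intro: sets_time_mark_space_Times\<close>)
  \<comment> \<open>Marks in \<open>A\<close> are nonzero, so membership of the jump in
    \<open>A\<close> absorbs the condition defining \<open>?J\<close>.\<close>
  also have "(\<lambda>s. (s, jump g s)) -` ({0..u} \<times> A) \<inter> ?J = {s. 0 < s \<and> s \<le> u \<and> jump g s \<in> A}"
    using A0 by auto
  also have "emeasure (count_space ?J) \<dots> = emeasure (count_space UNIV) \<dots>"
    using A0 by (subst (1 2) emeasure_count_space) auto
  finally show ?thesis .
qed

section \<open>Necessity: continuity and densities of the paths of an Ito process\<close>

section \<open>Deterministic Ito processes\<close>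

text \<open>A jump at \<open>t\<close> raises the finite count of big jumps by at least one over its
  value at every earlier time, whereas a measure with a Lebesgue density gives no mass to
  \<open>t\<close>.\<close>

lemma continuous_on_if_jump_intensity:
  fixes g :: "real \<Rightarrow> 'v::real_normed_vector"
  assumes g: "cadlag g"
    and intensity: "\<And>\<epsilon>. 0 < \<epsilon> \<Longrightarrow> \<exists>G \<in> borel_measurable lborel. \<forall>u\<ge>0.
      (\<integral>\<^sup>+s\<in>{0..u}. G s \<partial>lborel) =
        emeasure (count_space UNIV) {s. 0 < s \<and> s \<le> u \<and> \<epsilon> < norm (jump g s)}"
  shows "continuous_on {0..} g"
proof (rule continuous_on_if_jump_eq_0[OF g], rule ccontr)
  fix t :: real assume t: "t > 0" "jump g t \<noteq> 0"
  \<comment> \<open>Half the size of the jump, so that \<open>t\<close> passes the strict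
    threshold.\<close>
  define \<epsilon> where "\<epsilon> = norm (jump g t) / 2"
  have "\<epsilon> > 0"
    using t by (simp add: \<epsilon>_def)
  define J where "J u = {s. 0 < s \<and> s \<le> u \<and> \<epsilon> < norm (jump g s)}" for u
  have fin: "finite (J u)" for u
    unfolding J_def by (rule finite_big_jumps[OF g \<open>\<epsilon> > 0\<close>])
  obtain G where [measurable]: "G \<in> borel_measurable lborel"
    and G: "\<And>u. 0 \<le> u \<Longrightarrow> (\<integral>\<^sup>+s\<in>{0..u}. G s \<partial>lborel) = emeasure (count_space UNIV) (J u)"
    using intensity[OF \<open>\<epsilon> > 0\<close>] unfolding J_def by blast
  define \<mu> where "\<mu> = density lborel G"
  have \<mu>: "emeasure \<mu> {0..u} = of_nat (card (J u))" if "0 \<le> u" for u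
    using G[OF that] fin[of u] by (simp add: \<mu>_def emeasure_density)
  have "t \<in> J t"
    using t by (simp add: J_def \<epsilon>_def)
  have less: "card (J u) \<le> card (J t) - 1" if "u < t" for u
  proof -
    have "J u \<subseteq> J t - {t}"
      using that by (auto simp: J_def)
    then show ?thesis
      using card_mono[of "J t - {t}" "J u"] fin \<open>t \<in> J t\<close> by simp
  qed
  \<comment> \<open>An increasing sequence from 0 to \<open>t\<close> that stays strictly below
    \<open>t\<close>; the intervals \<open>{0..u n}\<close> exhaust \<open>{0..<t}\<close>.\<close>
  define u where "u n = t - t / real (Suc n)" for n
  have u: "0 \<le> u n" "u n < t" "u n \<le> u (Suc n)" for n
    using t by (simp_all add: u_def field_simps)
  have "u \<longlonglongrightarrow> t - 0"
    unfolding u_def using LIMSEQ_Suc[OF lim_const_over_n[of t]] by (intro tendsto_intros)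
  then have "(\<Union>n. {0..u n}) = {0..<t}"
  proof (intro equalityI subsetI)
    fix s assume "u \<longlonglongrightarrow> t - 0" "s \<in> {0..<t}"
    then have "\<forall>\<^sub>F n in sequentially. s < u n"
      by (intro order_tendstoD(1)) auto
    then obtain n where "s < u n"
      by (auto simp: eventually_sequentially)
    with \<open>s \<in> {0..<t}\<close> show "s \<in> (\<Union>n. {0..u n})"
      by (intro UN_I[of n]) auto
  qed (use u in \<open>force dest: le_less_trans\<close>)
  then have "emeasure \<mu> {0..<t} = (SUP n. emeasure \<mu> {0..u n})"
    using u(3) by (subst SUP_emeasure_incseq) (auto simp: \<mu>_def incseq_Suc_iff)
  also have "\<dots> \<le> of_nat (card (J t) - 1)"
    using \<mu> u less by (intro SUP_least) simp
  finally have "emeasure \<mu> {0..<t} \<le> of_nat (card (J t) - 1)" .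
  moreover have "{0..t} = {0..<t} \<union> {t}"
    using t by auto
  then have "emeasure \<mu> {0..t} = emeasure \<mu> {0..<t} + emeasure \<mu> {t}"
    by (subst plus_emeasure) (auto simp: \<mu>_def)
  moreover have "emeasure \<mu> {t} = 0"
  proof -
    have "AE s in lborel. s \<notin> {t}"
      by (rule AE_not_in) auto
    then have "AE s in lborel. s \<in> {t} \<longrightarrow> G s \<le> 0"
      by eventually_elim simp
    then have "{t} \<in> null_sets \<mu>"
      unfolding \<mu>_def by (subst null_sets_density_iff) auto
    then show ?thesis by auto
  qed
  ultimately have "(of_nat (card (J t)) :: ennreal) \<le> of_nat (card (J t) - 1)"
    using \<mu>[of t] t by simp
  then have "card (J t) \<le> card (J t) - 1"
    by (simp only: of_nat_le_iff)
  \<comment> \<open>Natural number subtraction truncates at 0, so the contradiction requires a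
    positive count.\<close>
  moreover have "card (J t) > 0"
    using \<open>t \<in> J t\<close> fin card_gt_0_iff by blast
  ultimately show False by simp
qed

text \<open>The compensator identity is tested on the indicator of \<open>{0..u} \<times> A\<close>,
  a predictable integrand without randomness. The jump measure of \<open>g\<close> is not random
  either, so its expectation disappears.\<close>

lemma jump_compensator_Times:
  fixes g :: "real \<Rightarrow> 'v::real_normed_vector"
  assumes sb: "stochastic_basis M F" and comp: "jump_compensator M F (\<lambda>t \<omega>. g t) \<nu>"
    and A: "A \<in> sets mark_space"
  shows "(\<integral>\<^sup>+\<omega>. emeasure (\<nu> \<omega>) ({0..u} \<times> A) \<partial>M) = emeasure (jump_measure g) ({0..u} \<times> A)"
proof -
  from sb interpret prob_space M
    by (simp add: stochastic_basis_def)
  note [measurable] = A measurable_fst_predictable_space[OF sb]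
  define W :: "(real \<times> 'a) \<times> 'v \<Rightarrow> ennreal" where
    "W p = indicator {0..u} (fst (fst p)) * indicator A (snd p)" for p
  have "W \<in> borel_measurable (predictable_space M F \<Otimes>\<^sub>M mark_space)"
    unfolding W_def by measurable
  then have *: "(\<integral>\<^sup>+\<omega>. (\<integral>\<^sup>+(s, y). W ((s, \<omega>), y) \<partial>\<nu> \<omega>) \<partial>M) =
        (\<integral>\<^sup>+\<omega>. (\<integral>\<^sup>+(s, y). W ((s, \<omega>), y) \<partial>jump_measure g) \<partial>M)"
    using comp unfolding jump_compensator_def by blast
  have W: "(\<lambda>(s, y). W ((s, \<omega>), y)) = indicator ({0..u} \<times> A)" for \<omega>
    by (auto simp: W_def indicator_def fun_eq_iff)
  have S: "{0..u} \<times> A \<in> sets time_mark_space"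
    using A by (intro sets_time_mark_space_Times) auto
  have "(\<integral>\<^sup>+(s, y). W ((s, \<omega>), y) \<partial>\<nu> \<omega>) = emeasure (\<nu> \<omega>) ({0..u} \<times> A)" if "\<omega> \<in> space M" for \<omega>
    using comp that S unfolding W jump_compensator_def predictable_random_measure_def
    by (intro nn_integral_indicator) auto
  moreover have "(\<integral>\<^sup>+(s, y). W ((s, \<omega>), y) \<partial>jump_measure g) = emeasure (jump_measure g) ({0..u} \<times> A)" for \<omega>
    unfolding W by (rule nn_integral_indicator) (use S in \<open>simp add: jump_measure_def\<close>)
  ultimately show ?thesis
    using * by (simp add: emeasure_space_1 cong: nn_integral_cong)
qed

text \<open>Fixes a starting point and separates the drift formula from the jump formula, which
  enter two different arguments.\<close>

lemma ito_processE:
  fixes X :: "real^'d \<Rightarrow> real \<Rightarrow> 'w \<Rightarrow> real^'d"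
  assumes "ito_process M F h X"
  obtains \<l> :: "real^'d \<Rightarrow> real^'d" and N B C \<nu> where
    "transition_kernel N"
    "characteristics M F h (X x) B C \<nu>"
    "AE \<omega> in M. \<forall>t\<ge>0. \<forall>j. set_integrable lborel {0..t} (\<lambda>s. \<l> (X x s \<omega>) $ j) \<and>
       B t \<omega> $ j = (LINT s:{0..t}|lborel. \<l> (X x s \<omega>) $ j)"
    "AE \<omega> in M. \<forall>t\<ge>0. \<forall>A\<in>sets mark_space.
       emeasure (\<nu> \<omega>) ({0..t} \<times> A) = (\<integral>\<^sup>+s\<in>{0..t}. emeasure (N (X x s \<omega>)) A \<partial>lborel)"
proof -
  from assms[unfolded ito_process_def] show thesis
  proof (elim exE conjE)
    fix \<l> Q N
    assume N: "transition_kernel N" and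
      *: "\<forall>x. \<exists>B C \<nu>. characteristics M F h (X x) B C \<nu> \<and>
           (AE \<omega> in M. \<forall>t\<ge>0.
              (\<forall>j. set_integrable lborel {0..t} (\<lambda>s. \<l> (X x s \<omega>) $ j) \<and>
                 B t \<omega> $ j = (LINT s:{0..t}|lborel. \<l> (X x s \<omega>) $ j)) \<and>
              (\<forall>j k. set_integrable lborel {0..t} (\<lambda>s. Q (X x s \<omega>) $ j $ k) \<and>
                 C t \<omega> $ j $ k = (LINT s:{0..t}|lborel. Q (X x s \<omega>) $ j $ k)) \<and>
              (\<forall>A\<in>sets mark_space.
                 emeasure (\<nu> \<omega>) ({0..t} \<times> A) =
                   (\<integral>\<^sup>+s\<in>{0..t}. emeasure (N (X x s \<omega>)) A \<partial>lborel)))"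
    from *[rule_format, of x] show thesis
    proof (elim exE conjE)
      fix B C \<nu>
      assume char: "characteristics M F h (X x) B C \<nu>" and
        AE: "AE \<omega> in M. \<forall>t\<ge>0.
              (\<forall>j. set_integrable lborel {0..t} (\<lambda>s. \<l> (X x s \<omega>) $ j) \<and>
                 B t \<omega> $ j = (LINT s:{0..t}|lborel. \<l> (X x s \<omega>) $ j)) \<and>
              (\<forall>j k. set_integrable lborel {0..t} (\<lambda>s. Q (X x s \<omega>) $ j $ k) \<and>
                 C t \<omega> $ j $ k = (LINT s:{0..t}|lborel. Q (X x s \<omega>) $ j $ k)) \<and>
              (\<forall>A\<in>sets mark_space.
                 emeasure (\<nu> \<omega>) ({0..t} \<times> A) =
                   (\<integral>\<^sup>+s\<in>{0..t}. emeasure (N (X x s \<omega>)) A \<partial>lborel))"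
      show thesis
        by (rule that[OF N char, of \<l>]) (use AE in \<open>eventually_elim, blast\<close>)+
    qed
  qed
qed

text \<open>The kernel mass of the marks larger than \<open>\<epsilon>\<close>, evaluated along the
  path, is the density that \<open>continuous_on_if_jump_intensity\<close> asks for.\<close>

lemma deterministic_ito_continuous_on:
  fixes X :: "real^'d \<Rightarrow> real \<Rightarrow> real^'d"
  assumes sb: "stochastic_basis M F" and ito: "deterministic_ito M F h X"
  shows "continuous_on {0..} (X x)"
proof (rule continuous_on_if_jump_intensity)
  from sb interpret prob_space M
    by (simp add: stochastic_basis_def)
  show cadlag: "cadlag (X x)"
    using ito by (simp add: deterministic_ito_def deterministic_markov_def)
  fix \<epsilon> :: real assume "\<epsilon> > 0"
  define A :: "(real^'d) set" where "A = {y. \<epsilon> < norm y}"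
  have A: "A \<in> sets mark_space"
    unfolding mark_space_def A_def
    by (subst sets_restrict_space_iff) (use \<open>\<epsilon> > 0\<close> in \<open>auto simp: borel_closed\<close>)
  from ito have "ito_process M F h (\<lambda>x t \<omega>. X x t)"
    by (simp add: deterministic_ito_def)
  then obtain N B C \<nu> where N: "transition_kernel N"
    and char: "characteristics M F h (\<lambda>t \<omega>. X x t) B C \<nu>"
    and \<nu>: "AE \<omega> in M. \<forall>t\<ge>0. \<forall>A\<in>sets mark_space.
        emeasure (\<nu> \<omega>) ({0..t} \<times> A) = (\<integral>\<^sup>+s\<in>{0..t}. emeasure (N (X x s)) A \<partial>lborel)"
    by (rule ito_processE[where x = x])
  from char have comp: "jump_compensator M F (\<lambda>t \<omega>. X x t) \<nu>"
    by (simp add: characteristics_def)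
  \<comment> \<open>The path is known to be measurable only on nonnegative times, hence the
    cut-off.\<close>
  define G where "G s = emeasure (N (X x s)) A * indicator {0..} s" for s
  have "(\<lambda>y. emeasure (N y) A) \<in> borel_measurable borel"
    using N A by (simp add: transition_kernel_def)
  from measurable_compose[OF borel_measurable_cadlag[OF cadlag] this]
  have "G \<in> borel_measurable lborel"
    unfolding G_def by (subst (asm) borel_measurable_restrict_space_iff_ennreal) auto
  moreover have "(\<integral>\<^sup>+s\<in>{0..u}. G s \<partial>lborel) =
      emeasure (count_space UNIV) {s. 0 < s \<and> s \<le> u \<and> \<epsilon> < norm (jump (X x) s)}" if "u \<ge> 0" for u
  proof -
    have "(\<integral>\<^sup>+s\<in>{0..u}. G s \<partial>lborel) = (\<integral>\<^sup>+s\<in>{0..u}. emeasure (N (X x s)) A \<partial>lborel)"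
      by (rule nn_integral_cong) (auto simp: G_def indicator_def)
    \<comment> \<open>Averaging a constant over a probability space changes nothing; it is done
      because the compensator identity holds in expectation and \<open>\<nu>\<close> may depend on
      \<open>\<omega>\<close>.\<close>
    also have "\<dots> = (\<integral>\<^sup>+\<omega>. (\<integral>\<^sup>+s\<in>{0..u}. emeasure (N (X x s)) A \<partial>lborel) \<partial>M)"
      by (simp add: emeasure_space_1)
    also have "\<dots> = (\<integral>\<^sup>+\<omega>. emeasure (\<nu> \<omega>) ({0..u} \<times> A) \<partial>M)"
      by (rule nn_integral_cong_AE) (use \<nu> in \<open>eventually_elim, use that A in simp\<close>)
    also have "\<dots> = emeasure (jump_measure (X x)) ({0..u} \<times> A)"
      by (rule jump_compensator_Times[OF sb comp A])
    finally show ?thesis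
      using emeasure_jump_measure[OF A] by (simp add: A_def)
  qed
  ultimately show "\<exists>G \<in> borel_measurable lborel. \<forall>u\<ge>0. (\<integral>\<^sup>+s\<in>{0..u}. G s \<partial>lborel) =
      emeasure (count_space UNIV) {s. 0 < s \<and> s \<le> u \<and> \<epsilon> < norm (jump (X x) s)}"
    by blast
qed

text \<open>By continuity no jumps are removed, so the path minus \<open>x\<close> minus
  \<open>B\<close> is a null local martingale. \<open>B\<close> agrees almost surely with the
  deterministic integral \<open>a\<close>, and the difference must vanish.\<close>

lemma deterministic_ito_abs_continuous:
  fixes X :: "real^'d \<Rightarrow> real \<Rightarrow> real^'d"
  assumes sb: "stochastic_basis M F" and h: "truncation_function h"
    and ito: "deterministic_ito M F h X"
  shows "abs_continuous (\<lambda>t. X x t $ j - x $ j)"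
proof -
  from sb interpret prob_space M
    by (simp add: stochastic_basis_def)
  have X0: "X x 0 = x"
    using ito by (simp add: deterministic_ito_def deterministic_markov_def)
  have cont: "continuous_on {0..} (X x)"
    by (rule deterministic_ito_continuous_on[OF sb ito])
  from ito have "ito_process M F h (\<lambda>x t \<omega>. X x t)"
    by (simp add: deterministic_ito_def)
  then obtain \<l> :: "real^'d \<Rightarrow> real^'d" and N B C \<nu> where
    char: "characteristics M F h (\<lambda>t \<omega>. X x t) B C \<nu>"
    and B: "AE \<omega> in M. \<forall>t\<ge>0. \<forall>j. set_integrable lborel {0..t} (\<lambda>s. \<l> (X x s) $ j) \<and>
                 B t \<omega> $ j = (LINT s:{0..t}|lborel. \<l> (X x s) $ j)"
    by (rule ito_processE[where x = x])
  from char have mart: "null_local_martingale M F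
          (\<lambda>t \<omega>. (remove_big_jumps h (\<lambda>s. X x s) t - X x 0 - B t \<omega>) $ j)"
    by (simp add: characteristics_def)
  define a where "a t = (LINT s:{0..t}|lborel. \<l> (X x s) $ j)" for t
  \<comment> \<open>The proposition does not mention \<open>\<omega>\<close>, and in a probability
    space a constant proposition that holds almost surely is true.\<close>
  have "AE \<omega> in M. \<forall>t\<ge>0. set_integrable lborel {0..t} (\<lambda>s. \<l> (X x s) $ j)"
    using B by eventually_elim simp
  then have a: "abs_continuous a"
    unfolding abs_continuous_def a_def by auto
  have "X x t $ j - x $ j - a t = 0" if "t \<ge> 0" for t
  proof (rule null_local_martingale_deterministic
      [OF sb mart, where g = "\<lambda>t. X x t $ j - x $ j - a t" and t = t])
    show "AE \<omega> in M. \<forall>t\<ge>0. (remove_big_jumps h (X x) t - X x 0 - B t \<omega>) $ j = X x t $ j - x $ j - a t"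
      using B by eventually_elim (simp add: remove_big_jumps_continuous_on[OF cont h] X0 a_def)
    show "continuous_on {0..} (\<lambda>t. X x t $ j - x $ j - a t)"
      by (intro continuous_on_diff continuous_on_const abs_continuous_imp_continuous_on[OF a]
          continuous_on_component cont)
  qed (rule that)
  then show ?thesis
    using a by (simp add: abs_continuous_def)
qed

section \<open>Quasi-left continuity and the equivalence\<close>

text \<open>Limits of nonnegative times are nonnegative, so continuity on the half line gives
  convergence for every \<open>\<omega>\<close>.\<close>

lemma quasi_left_continuous_deterministic:
  fixes M :: "'w measure" and g :: "real \<Rightarrow> 'a::topological_space"
  assumes "continuous_on {0..} g"
  shows "quasi_left_continuous M F (\<lambda>t \<omega>. g t)"
  unfolding quasi_left_continuous_def
proof (intro allI impI, elim conjE)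
  fix T :: "nat \<Rightarrow> 'w \<Rightarrow> real"
  assume T: "\<forall>n. \<forall>\<omega>\<in>space M. 0 \<le> T n \<omega> \<and> T n \<omega> \<le> T (Suc n) \<omega>"
  have "(\<lambda>n. g (T n \<omega>)) \<longlonglongrightarrow> g \<tau>" if "\<omega> \<in> space M" "(\<lambda>n. T n \<omega>) \<longlonglongrightarrow> \<tau>" for \<omega> \<tau>
    by (rule continuous_on_tendsto_compose[OF assms that(2)])
       (use T that in \<open>auto intro!: always_eventually LIMSEQ_le_const[OF that(2)]\<close>)
  then show "AE \<omega> in M. \<forall>\<tau>. (\<lambda>n. T n \<omega>) \<longlonglongrightarrow> \<tau> \<longrightarrow> (\<lambda>n. g (T n \<omega>)) \<longlonglongrightarrow> g \<tau>"
    by (intro AE_I2) blast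
qed

theorem proposition2p9:
  fixes M :: "'w measure" and F :: "real \<Rightarrow> 'w measure"
    and h :: "real^'d \<Rightarrow> real^'d" and f :: "real \<Rightarrow> real^'d"
  assumes "stochastic_basis M F"
    and "truncation_function h"
    and "cadlag f"
  shows "ito_expandable M F h f \<longleftrightarrow>
    hunt_expandable M F f \<and> (\<forall>j. abs_continuous (\<lambda>t. f t $ j - f 0 $ j))"
proof (intro iffI conjI allI; (elim conjE)?)
  assume "ito_expandable M F h f"
  then obtain X where X: "deterministic_ito M F h X" and f: "\<And>t. t \<ge> 0 \<Longrightarrow> X (f 0) t = f t"
    by (auto simp: ito_expandable_def)
  have "quasi_left_continuous M F (\<lambda>t \<omega>. X x t)" for x
    by (rule quasi_left_continuous_deterministic)
       (rule deterministic_ito_continuous_on[OF assms(1) X])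
  then have "deterministic_hunt M F X"
    using X by (simp add: deterministic_hunt_def deterministic_ito_def)
  then show "hunt_expandable M F f"
    using f by (auto simp: hunt_expandable_def)
  fix j
  \<comment> \<open>\<open>abs_continuous\<close> inspects only nonnegative times, where
    \<open>X (f 0)\<close> coincides with \<open>f\<close>.\<close>
  show "abs_continuous (\<lambda>t. f t $ j - f 0 $ j)"
    using deterministic_ito_abs_continuous[OF assms(1,2) X, of "f 0" j] f
    by (simp add: abs_continuous_def)
next
  assume "hunt_expandable M F f" "\<forall>j. abs_continuous (\<lambda>t. f t $ j - f 0 $ j)"
  then show "ito_expandable M F h f"
    by (intro ito_expandableI assms(1,2)) auto
qed

end
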